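(* Let $H$ be a complex Hilbert space and let $A$ be a $^*$-subalgebra of $B(H)$ (not assumed closed and not assumed unital). The following are equivalent. (1) $A$ is regular in the sense of von Neumann: for each $x\in A$ there exists $y\in A$ with $xyx=x$. (2) $A$ is algebraic: for each $x\in A$ the subalgebra of $B(H)$ generated by $x$ is finite-dimensional. (3) Each operator in $A$ has closed range. (4) Each operator in $A$ has finite spectrum (spectrum taken in $B(H)$). (5) Each self-adjoint operator in $A$ has closed range. (6) Each self-adjoint operator in $A$ has finite spectrum.
   Context: $B(H)$ denotes the algebra of bounded linear operators on $H$. Subalgebras are not assumed norm closed. *)

theory Defs
  imports "HOL-Analysis.Analysis"
begin

class cvector = ab_group_add +
  fixes scaleC :: "complex \<Rightarrow> 'a \<Rightarrow> 'a" (infixr \<open>*\<^sub>C\<close> 75)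
  assumes scaleC_add_right: "a *\<^sub>C (x + y) = a *\<^sub>C x + a *\<^sub>C y"
    and scaleC_add_left: "(a + b) *\<^sub>C x = a *\<^sub>C x + b *\<^sub>C x"
    and scaleC_scaleC: "a *\<^sub>C (b *\<^sub>C x) = (a * b) *\<^sub>C x"
    and scaleC_one: "1 *\<^sub>C x = x"

class cinner_space = real_normed_vector + cvector +
  fixes cinner :: "'a \<Rightarrow> 'a \<Rightarrow> complex"
  assumes scaleR_scaleC: "scaleR r x = complex_of_real r *\<^sub>C x"
    and cinner_add_right: "cinner x (y + z) = cinner x y + cinner x z"
    and cinner_scaleC_right: "cinner x (c *\<^sub>C y) = c * cinner x y"
    and cinner_commute: "cinner y x = cnj (cinner x y)"
    and cinner_self_real: "Im (cinner x x) = 0"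
    and cinner_self_nonneg: "0 \<le> Re (cinner x x)"
    and cinner_self_eq_zero: "cinner x x = 0 \<longleftrightarrow> x = 0"
    and norm_eq_sqrt_cinner: "norm x = sqrt (Re (cinner x x))"

class chilbert_space = cinner_space + complete_space

definition clinear_op :: "('a::cvector \<Rightarrow> 'b::cvector) \<Rightarrow> bool" where
  "clinear_op T \<longleftrightarrow> (\<forall>x y. T (x + y) = T x + T y) \<and> (\<forall>c x. T (c *\<^sub>C x) = c *\<^sub>C T x)"

definition bounded_op :: "('a::cinner_space \<Rightarrow> 'a) \<Rightarrow> bool" where
  "bounded_op T \<longleftrightarrow> clinear_op T \<and> (\<exists>K. \<forall>x. norm (T x) \<le> norm x * K)"

definition BH :: "('a::cinner_space \<Rightarrow> 'a) set" where
  "BH = {T. bounded_op T}"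

definition is_adjoint :: "('a::cinner_space \<Rightarrow> 'a) \<Rightarrow> ('a \<Rightarrow> 'a) \<Rightarrow> bool" where
  "is_adjoint S T \<longleftrightarrow> S \<in> BH \<and> (\<forall>x y. cinner (T x) y = cinner x (S y))"

definition self_adjoint :: "('a::cinner_space \<Rightarrow> 'a) \<Rightarrow> bool" where
  "self_adjoint T \<longleftrightarrow> T \<in> BH \<and> (\<forall>x y. cinner (T x) y = cinner x (T y))"

definition subalgebra_BH :: "('a::cinner_space \<Rightarrow> 'a) set \<Rightarrow> bool" where
  "subalgebra_BH A \<longleftrightarrow> A \<subseteq> BH \<and> (\<lambda>v. 0) \<in> A
     \<and> (\<forall>S\<in>A. \<forall>T\<in>A. (\<lambda>v. S v + T v) \<in> A)
     \<and> (\<forall>c. \<forall>T\<in>A. (\<lambda>v. c *\<^sub>C T v) \<in> A)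
     \<and> (\<forall>S\<in>A. \<forall>T\<in>A. S \<circ> T \<in> A)"

definition star_subalgebra_BH :: "('a::cinner_space \<Rightarrow> 'a) set \<Rightarrow> bool" where
  "star_subalgebra_BH A \<longleftrightarrow> subalgebra_BH A \<and> (\<forall>T\<in>A. \<exists>S\<in>A. is_adjoint S T)"

definition generated_subalgebra :: "('a::cinner_space \<Rightarrow> 'a) \<Rightarrow> ('a \<Rightarrow> 'a) set" where
  "generated_subalgebra x = \<Inter>{B. subalgebra_BH B \<and> x \<in> B}"

definition op_span :: "('a::cvector \<Rightarrow> 'a) set \<Rightarrow> ('a \<Rightarrow> 'a) set" where
  "op_span F = {T. \<exists>G c. finite G \<and> G \<subseteq> F \<and> T = (\<lambda>v. \<Sum>f\<in>G. c f *\<^sub>C f v)}"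

definition fin_dim_ops :: "('a::cvector \<Rightarrow> 'a) set \<Rightarrow> bool" where
  "fin_dim_ops B \<longleftrightarrow> (\<exists>F. finite F \<and> F \<subseteq> B \<and> B \<subseteq> op_span F)"

definition spectrum_BH :: "('a::cinner_space \<Rightarrow> 'a) \<Rightarrow> complex set" where
  "spectrum_BH T = {l. \<not> (\<exists>S\<in>BH. S \<circ> (\<lambda>v. T v - l *\<^sub>C v) = id \<and> (\<lambda>v. T v - l *\<^sub>C v) \<circ> S = id)}"

end

theory Submission
  imports Defs "HOL-Computational_Algebra.Fundamental_Theorem_Algebra" "HOL-Library.Function_Algebras"
begin

text \<open>
  All six conditions are equivalent to: every self-adjoint \<open>h \<in> A\<close> is annihilated by a nonzero
  polynomial. If this holds, then for \<open>x \<in> A\<close> the element \<open>h = x\<^sup>* x\<close> satisfies \<open>h q(h) h = h\<close> for some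
  polynomial \<open>q\<close>, and \<open>y = q(h) x\<^sup>*\<close> is a quasi-inverse of \<open>x\<close>. Moreover, writing \<open>x = a + i b\<close> with
  \<open>a\<close> and \<open>b\<close> self-adjoint, \<open>a + t b\<close> is algebraic for every real \<open>t\<close>, hence of bounded degree for
  infinitely many \<open>t\<close>; linear dependence of its powers is a polynomial condition on \<open>t\<close>, so it
  extends to \<open>t = i\<close> and \<open>x\<close> is algebraic. Conversely, a self-adjoint \<open>T\<close> with finite spectrum is
  algebraic because a self-adjoint polynomial in \<open>T\<close> that vanishes on the spectrum is zero. If the
  spectrum of \<open>T\<close> is infinite, it accumulates at some real \<open>a\<close>; then \<open>0\<close> is not isolated in the
  spectrum of \<open>T (T - a) \<in> A\<close>, whose range is therefore not closed.
\<close>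

section \<open>Inner products and bounded operators\<close>

lemma scaleC_zero_left [simp]: "0 *\<^sub>C x = (0 :: 'a::cvector)"
  using scaleC_add_left[of 0 0 x] by simp

lemma scaleC_zero_right [simp]: "a *\<^sub>C 0 = (0 :: 'a::cvector)"
  using scaleC_add_right[of a 0 "0::'a"] by simp

lemma scaleC_minus_left: "(- a) *\<^sub>C x = - (a *\<^sub>C (x :: 'a::cvector))"
  using scaleC_add_left[of a "-a" x] by (simp add: eq_neg_iff_add_eq_0 add.commute)

lemma scaleC_minus_right: "a *\<^sub>C (- x) = - (a *\<^sub>C (x :: 'a::cvector))"
  using scaleC_add_right[of a x "-x"] by (simp add: eq_neg_iff_add_eq_0 add.commute)

lemma scaleC_diff_right: "a *\<^sub>C (x - y) = a *\<^sub>C x - a *\<^sub>C (y :: 'a::cvector)"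
  using scaleC_add_right[of a x "-y"] by (simp add: scaleC_minus_right)

lemma cinner_add_left: "cinner (x + y) z = cinner x z + cinner y z"
  by (metis cinner_add_right cinner_commute complex_cnj_add)

lemma cinner_scaleC_left: "cinner (c *\<^sub>C x) y = cnj c * cinner x y"
  by (metis cinner_scaleC_right cinner_commute complex_cnj_mult)

lemma cinner_zero_right [simp]: "cinner x 0 = 0"
  using cinner_add_right[of x 0 0] by simp

lemma cinner_zero_left [simp]: "cinner 0 x = 0"
  using cinner_add_left[of 0 0 x] by simp

lemma cinner_minus_right: "cinner x (- y) = - cinner x y"
  using cinner_add_right[of x y "- y"] by (simp add: eq_neg_iff_add_eq_0 add.commute)

lemma cinner_minus_left: "cinner (- x) y = - cinner x y"
  using cinner_add_left[of x "- x" y] by (simp add: eq_neg_iff_add_eq_0 add.commute)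

lemma cinner_diff_right: "cinner x (y - z) = cinner x y - cinner x z"
  using cinner_add_right[of x y "- z"] by (simp add: cinner_minus_right)

lemma cinner_diff_left: "cinner (x - y) z = cinner x z - cinner y z"
  using cinner_add_left[of x "- y" z] by (simp add: cinner_minus_left)

lemma cinner_sum_right: "cinner x (\<Sum>i\<in>I. f i) = (\<Sum>i\<in>I. cinner x (f i))"
  by (induction I rule: infinite_finite_induct) (simp_all add: cinner_add_right)

lemma norm_sq_cinner: "(norm x)\<^sup>2 = Re (cinner x x)"
  by (simp add: norm_eq_sqrt_cinner cinner_self_nonneg)

lemma cinner_self: "cinner x x = complex_of_real ((norm x)\<^sup>2)"
  by (simp add: complex_eq_iff norm_sq_cinner cinner_self_real)

lemma Re_cinner_commute: "Re (cinner x y) = Re (cinner y x)"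
  using cinner_commute[of x y] by simp

lemma norm_scaleC [simp]: "norm (c *\<^sub>C (x :: 'a::cinner_space)) = cmod c * norm x"
proof -
  have "cinner (c *\<^sub>C x) (c *\<^sub>C x) = (c * cnj c) * cinner x x"
    by (simp add: cinner_scaleC_left cinner_scaleC_right)
  also have "\<dots> = complex_of_real ((cmod c * norm x)\<^sup>2)"
    by (simp add: cinner_self power_mult_distrib flip: complex_norm_square)
  finally have "(norm (c *\<^sub>C x))\<^sup>2 = (cmod c * norm x)\<^sup>2"
    by (simp only: norm_sq_cinner[of "c *\<^sub>C x"] Re_complex_of_real)
  thus ?thesis by (simp add: power2_eq_iff_nonneg)
qed

lemma norm_sq_add: "(norm (x + y))\<^sup>2 = (norm x)\<^sup>2 + 2 * Re (cinner x y) + (norm (y :: 'a::cinner_space))\<^sup>2"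
  by (simp add: norm_sq_cinner cinner_add_left cinner_add_right Re_cinner_commute)

lemma norm_sq_diff: "(norm (x - y))\<^sup>2 = (norm x)\<^sup>2 - 2 * Re (cinner x y) + (norm (y :: 'a::cinner_space))\<^sup>2"
  using norm_sq_add[of x "- y"] by (simp add: cinner_minus_right)

lemma abs_Re_cinner_le: "\<bar>Re (cinner x y)\<bar> \<le> norm x * norm (y :: 'a::cinner_space)"
proof -
  have *: "Re (cinner x y) \<le> norm x * norm y" for y :: 'a
  proof -
    have "(norm (x + y))\<^sup>2 \<le> (norm x + norm y)\<^sup>2"
      by (intro power_mono norm_triangle_ineq) simp
    thus ?thesis by (simp add: norm_sq_add power2_sum)
  qed
  from *[of y] *[of "- y"] show ?thesis by (simp add: cinner_minus_right)
qed

lemma clinear_opD: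
  assumes "clinear_op T"
  shows "T (x + y) = T x + T y" "T (c *\<^sub>C x) = c *\<^sub>C T x" "T 0 = 0" "T (- x) = - T x"
    "T (x - y) = T x - T y"
proof -
  show add: "T (x + y) = T x + T y" and "T (c *\<^sub>C x) = c *\<^sub>C T x" for x y c
    using assms by (auto simp: clinear_op_def)
  show zero: "T 0 = 0" using add[of 0 0] by simp
  show minus: "T (- x) = - T x" for x
    using add[of x "-x"] zero by (simp add: eq_neg_iff_add_eq_0 add.commute)
  show "T (x - y) = T x - T y"
    using add[of x "- y"] by (simp add: minus)
qed

lemma BH_clinear: "T \<in> BH \<Longrightarrow> clinear_op T"
  by (simp add: BH_def bounded_op_def)

lemma BH_bound:
  assumes "T \<in> BH"
  obtains K where "K > 0" "\<And>x. norm (T x) \<le> K * norm x"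
proof -
  obtain K where K: "\<And>x. norm (T x) \<le> norm x * K"
    using assms by (auto simp: BH_def bounded_op_def)
  have "norm (T x) \<le> (\<bar>K\<bar> + 1) * norm x" for x
    using K[of x] by (subst mult.commute) (rule order.trans, assumption, rule mult_left_mono, auto)
  thus ?thesis by (intro that[of "\<bar>K\<bar> + 1"]) auto
qed

lemma BH_I:
  assumes "clinear_op T" "\<And>x. norm (T x) \<le> K * norm x"
  shows "T \<in> BH"
  using assms by (auto simp: BH_def bounded_op_def mult.commute)

lemma BH_bounded_linear:
  assumes "T \<in> BH"
  shows "bounded_linear T"
proof -
  obtain K where K: "\<And>x. norm (T x) \<le> K * norm x" using BH_bound[OF assms] by blast
  show ?thesis
    using K by (intro bounded_linear_intro[of _ K])
      (auto simp: clinear_opD[OF BH_clinear[OF assms]] scaleR_scaleC mult.commute)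
qed

lemma BH_zero: "(\<lambda>v. 0) \<in> BH"
  by (rule BH_I[of _ 0]) (auto simp: clinear_op_def)

lemma BH_id: "id \<in> BH"
  by (rule BH_I[of _ 1]) (auto simp: clinear_op_def)

lemma BH_add:
  assumes "S \<in> BH" "T \<in> BH"
  shows "(\<lambda>v. S v + T v) \<in> BH"
proof -
  obtain K L where "\<And>x. norm (S x) \<le> K * norm x" "\<And>x. norm (T x) \<le> L * norm x"
    using BH_bound assms by metis
  hence "norm (S x + T x) \<le> (K + L) * norm x" for x
    using norm_triangle_ineq[of "S x" "T x"] by (smt (verit) distrib_right)
  thus ?thesis
    using assms[THEN BH_clinear]
    by (intro BH_I[of _ "K + L"]) (auto simp: clinear_op_def scaleC_add_right)
qed

lemma BH_scaleC:
  assumes "T \<in> BH"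
  shows "(\<lambda>v. c *\<^sub>C T v) \<in> BH"
proof -
  obtain L where "\<And>x. norm (T x) \<le> L * norm x"
    using BH_bound assms by metis
  hence "norm (c *\<^sub>C T x) \<le> (cmod c * L) * norm x" for x
    by (simp add: mult_left_mono mult.assoc)
  thus ?thesis
    using assms[THEN BH_clinear]
    by (intro BH_I[of _ "cmod c * L"]) (auto simp: clinear_op_def scaleC_add_right scaleC_scaleC mult.commute)
qed

lemma BH_comp:
  assumes "S \<in> BH" "T \<in> BH"
  shows "S \<circ> T \<in> BH"
proof -
  obtain K L where "K > 0" "\<And>x. norm (S x) \<le> K * norm x" "\<And>x. norm (T x) \<le> L * norm x"
    using BH_bound assms by metis
  hence "norm (S (T x)) \<le> (K * L) * norm x" for x
    by (smt (verit) mult.assoc mult_left_mono)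
  thus ?thesis
    using assms[THEN BH_clinear]
    by (intro BH_I[of _ "K * L"]) (auto simp: clinear_op_def)
qed

lemma BH_shift: "T \<in> BH \<Longrightarrow> (\<lambda>v. T v - l *\<^sub>C v) \<in> BH"
  using BH_add[of T "\<lambda>v. (- l) *\<^sub>C id v"] BH_scaleC[OF BH_id, of "-l"]
  by (simp add: scaleC_minus_left)

lemma self_adjoint_BH: "self_adjoint T \<Longrightarrow> T \<in> BH"
  by (simp add: self_adjoint_def)

lemma self_adjoint_cinner: "self_adjoint T \<Longrightarrow> cinner (T x) y = cinner x (T y)"
  by (simp add: self_adjoint_def)

lemma self_adjoint_Re_combination:
  assumes "self_adjoint S" "self_adjoint T"
  shows "self_adjoint (\<lambda>v. S v + complex_of_real t *\<^sub>C T v)"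
  using assms BH_add BH_scaleC unfolding self_adjoint_def
  by (auto simp: cinner_add_left cinner_add_right cinner_scaleC_left cinner_scaleC_right)

section \<open>Polynomials in an operator\<close>

text \<open>Horner's scheme for p(T) v. The constant term of p acts as a multiple of the
  identity.\<close>

definition op_poly :: "('a::cvector \<Rightarrow> 'a) \<Rightarrow> complex poly \<Rightarrow> 'a \<Rightarrow> 'a" where
  "op_poly T p v = fold_coeffs (\<lambda>a w. a *\<^sub>C v + T w) p 0"

definition algebraic_op :: "('a::cvector \<Rightarrow> 'a) \<Rightarrow> bool" where
  "algebraic_op T \<longleftrightarrow> (\<exists>p. p \<noteq> 0 \<and> (\<forall>v. op_poly T p v = 0))"

lemma op_poly_0 [simp]: "op_poly T 0 v = 0"
  by (simp add: op_poly_def)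

context
  fixes T :: "'a::cvector \<Rightarrow> 'a"
  assumes T: "clinear_op T"
begin

lemma op_poly_pCons [simp]: "op_poly T (pCons a p) v = a *\<^sub>C v + T (op_poly T p v)"
  by (cases "p = 0 \<and> a = 0") (auto simp: op_poly_def clinear_opD[OF T])

lemma op_poly_add: "op_poly T (p + q) v = op_poly T p v + op_poly T q v"
  by (induction p q rule: poly_induct2) (simp_all add: clinear_opD[OF T] scaleC_add_left)

lemma op_poly_smult: "op_poly T (smult c p) v = c *\<^sub>C op_poly T p v"
  by (induction p) (simp_all add: clinear_opD[OF T] scaleC_add_right scaleC_scaleC)

lemma op_poly_diff: "op_poly T (p - q) v = op_poly T p v - op_poly T q v"
  using op_poly_add[of p "- q" v] op_poly_smult[of "-1" q v]
  by (simp add: scaleC_minus_left scaleC_one)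

lemma op_poly_mult: "op_poly T (p * q) v = op_poly T p (op_poly T q v)"
  by (induction p) (simp_all add: clinear_opD[OF T] op_poly_add op_poly_smult)

lemma op_poly_commute: "op_poly T p (T v) = T (op_poly T p v)"
  using op_poly_mult[of p "[:0, 1:]" v] op_poly_mult[of "[:0, 1:]" p v]
  by (simp add: clinear_opD[OF T] scaleC_one)

lemma op_poly_sum: "op_poly T (\<Sum>i\<in>I. f i) v = (\<Sum>i\<in>I. op_poly T (f i) v)"
  by (induction I rule: infinite_finite_induct) (simp_all add: op_poly_add)

lemma op_poly_monom: "op_poly T (monom a n) v = a *\<^sub>C (T ^^ n) v"
  by (induction n) (simp_all add: monom_0 monom_Suc clinear_opD[OF T])

lemma op_poly_eq_sum:
  assumes "degree p \<le> n"
  shows "op_poly T p v = (\<Sum>i\<le>n. coeff p i *\<^sub>C (T ^^ i) v)"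
  using arg_cong[OF poly_as_sum_of_monoms'[OF assms], of "\<lambda>p. op_poly T p v"]
  by (simp add: op_poly_sum op_poly_monom)

end

lemma op_poly_BH:
  assumes "T \<in> BH"
  shows "op_poly T p \<in> BH"
proof (induction p)
  case 0
  thus ?case using BH_zero by (simp add: op_poly_def[abs_def])
next
  case (pCons a p)
  have "op_poly T (pCons a p) = (\<lambda>v. a *\<^sub>C id v + (T \<circ> op_poly T p) v)"
    by (simp add: fun_eq_iff op_poly_pCons[OF BH_clinear[OF assms]])
  thus ?case using BH_add BH_scaleC BH_id BH_comp assms pCons by metis
qed

text \<open>A subalgebra need not contain the identity, so p(T) itself may lie outside
  \<open>B\<close>; composing with an element of \<open>B\<close> brings the constant term back
  inside.\<close>

lemma op_poly_comp_in_subalgebra: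
  assumes "subalgebra_BH B" "T \<in> B" "S \<in> B"
  shows "op_poly T p \<circ> S \<in> B"
proof (induction p)
  case 0
  thus ?case using assms by (simp add: op_poly_def[abs_def] subalgebra_BH_def comp_def)
next
  case (pCons a p)
  have T: "clinear_op T" using assms by (auto simp: subalgebra_BH_def intro: BH_clinear)
  have "op_poly T (pCons a p) \<circ> S = (\<lambda>v. a *\<^sub>C S v + (T \<circ> (op_poly T p \<circ> S)) v)"
    by (simp add: fun_eq_iff op_poly_pCons[OF T])
  moreover have "T \<circ> (op_poly T p \<circ> S) \<in> B" "(\<lambda>v. a *\<^sub>C S v) \<in> B"
    using assms pCons unfolding subalgebra_BH_def by blast+
  ultimately show ?case using assms unfolding subalgebra_BH_def by metis
qed

lemma op_poly_adjoint:
  assumes "self_adjoint T"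
  shows "cinner (op_poly T p x) y = cinner x (op_poly T (map_poly cnj p) y)"
proof (induction p arbitrary: y)
  case (pCons a p)
  note T = BH_clinear[OF self_adjoint_BH[OF assms]]
  show ?case
    using pCons self_adjoint_cinner[OF assms]
    by (simp add: map_poly_pCons op_poly_pCons[OF T] op_poly_commute[OF T] cinner_add_left cinner_add_right
        cinner_scaleC_left cinner_scaleC_right)
qed auto

section \<open>Spectra\<close>

lemma spectrum_bounded_below:
  assumes T: "T \<in> BH" and l: "l \<notin> spectrum_BH T"
  obtains c where "c > 0" "\<And>v. c * norm v \<le> norm (T v - l *\<^sub>C v)"
proof -
  obtain S where S: "S \<in> BH" "S \<circ> (\<lambda>v. T v - l *\<^sub>C v) = id"
    using l by (auto simp: spectrum_BH_def)
  obtain K where K: "K > 0" "\<And>v. norm (S v) \<le> K * norm v" using BH_bound[OF S(1)] by blast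
  have "norm v \<le> K * norm (T v - l *\<^sub>C v)" for v
    using K(2)[of "T v - l *\<^sub>C v"] fun_cong[OF S(2), of v] by simp
  thus ?thesis using K by (intro that[of "1 / K"]) (auto simp: field_simps)
qed

text \<open>The lower bound makes T - l injective, so the set-theoretic inverse is linear; read at
  \<open>S w\<close>, the same bound says that the inverse has norm at most 1/c.\<close>

lemma not_in_spectrumI:
  assumes T: "T \<in> BH" and c: "c > 0" "\<And>v. c * norm v \<le> norm (T v - l *\<^sub>C v)"
    and surj: "\<And>w. \<exists>v. T v - l *\<^sub>C v = w"
  shows "l \<notin> spectrum_BH T"
proof -
  define L where "L = (\<lambda>v. T v - l *\<^sub>C v)"
  have L: "clinear_op L" using BH_clinear[OF BH_shift[OF T]] by (simp add: L_def)
  have inj: "u = v" if "L u = L v" for u v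
    using c(1) c(2)[of "u - v"] that clinear_opD(5)[OF L, of u v]
    by (simp add: L_def mult_le_0_iff)
  define S where "S = (\<lambda>w. SOME v. L v = w)"
  have LS: "L (S w) = w" for w
    unfolding S_def by (rule someI_ex) (use surj in \<open>auto simp: L_def\<close>)
  have SL: "S (L v) = v" for v by (rule inj) (rule LS)
  have "S \<in> BH"
  proof (rule BH_I)
    show "clinear_op S"
      unfolding clinear_op_def
    proof (intro conjI allI)
      show "S (x + y) = S x + S y" for x y by (rule inj) (simp add: LS clinear_opD[OF L])
      show "S (a *\<^sub>C x) = a *\<^sub>C S x" for a x by (rule inj) (simp add: LS clinear_opD[OF L])
    qed
    show "norm (S w) \<le> (1 / c) * norm w" for w
      using c(1) c(2)[of "S w"] LS[of w] by (simp add: L_def field_simps)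
  qed
  thus ?thesis
    using LS SL unfolding spectrum_BH_def L_def by (auto simp: fun_eq_iff intro!: bexI[of _ S])
qed

lemma self_adjoint_shift:
  assumes "self_adjoint T"
  shows "cinner (T x - l *\<^sub>C x) y = cinner x (T y - cnj l *\<^sub>C y)"
  by (simp add: cinner_diff_left cinner_diff_right cinner_scaleC_left cinner_scaleC_right
      self_adjoint_cinner[OF assms])

text \<open>T - l is normal: it commutes with its adjoint T - cnj l, and a normal operator and its
  adjoint give vectors of equal norm.\<close>

lemma self_adjoint_norm_shift:
  assumes "self_adjoint T"
  shows "norm (T v - l *\<^sub>C v) = norm (T v - cnj l *\<^sub>C v)"
proof -
  note T = clinear_opD[OF BH_clinear[OF self_adjoint_BH[OF assms]]]
  have commute: "T (T v - cnj l *\<^sub>C v) - l *\<^sub>C (T v - cnj l *\<^sub>C v)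
      = T (T v - l *\<^sub>C v) - cnj l *\<^sub>C (T v - l *\<^sub>C v)"
    by (simp add: T scaleC_diff_right scaleC_scaleC mult.commute)
  have "cinner (T v - l *\<^sub>C v) (T v - l *\<^sub>C v) = cinner (T v - cnj l *\<^sub>C v) (T v - cnj l *\<^sub>C v)"
    using self_adjoint_shift[OF assms, of v l "T v - l *\<^sub>C v"]
      self_adjoint_shift[OF assms, of v "cnj l" "T v - cnj l *\<^sub>C v"] commute by simp
  thus ?thesis by (simp add: norm_eq_sqrt_cinner)
qed

text \<open>Writing \<open>L = T - l\<close>, the map \<open>v \<mapsto> v - s (L\<^sup>* L v - w)\<close> is a contraction for
  suitable small \<open>s > 0\<close>, and its fixed point solves \<open>L\<^sup>* L v = w\<close>.\<close>

lemma self_adjoint_bounded_below_surj: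
  fixes T :: "'a::chilbert_space \<Rightarrow> 'a"
  assumes sa: "self_adjoint T" and c: "c > 0" "\<And>v. c * norm v \<le> norm (T v - l *\<^sub>C v)"
  shows "\<exists>v. T v - l *\<^sub>C v = w"
proof -
  \<comment> \<open>The shift by \<open>cnj l\<close> is called \<open>L\<close> and its adjoint T -
    l is \<open>L'\<close>. Thus \<open>N\<close> is the adjoint of \<open>L\<close> times
    \<open>L\<close>, and N v = w exhibits \<open>L v\<close> as a preimage of w under T -
    l.\<close>
  define L where "L = (\<lambda>v. T v - cnj l *\<^sub>C v)"
  define L' where "L' = (\<lambda>v. T v - l *\<^sub>C v)"
  have BH: "L \<in> BH" "L' \<in> BH"
    using BH_shift[OF self_adjoint_BH[OF sa]] by (simp_all add: L_def L'_def)
  define N where "N = L' \<circ> L"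
  have N: "N \<in> BH" using BH_comp BH by (simp add: N_def)
  have adj: "cinner (N v) v = cinner (L v) (L v)" for v
    unfolding N_def L_def L'_def comp_def using self_adjoint_shift[OF sa, of _ l v] by simp
  have below: "c * norm v \<le> norm (L v)" for v
    using c(2)[of v] self_adjoint_norm_shift[OF sa, of v l] by (simp add: L_def)
  obtain K where K: "K > 0" "\<And>v. norm (N v) \<le> K * norm v" using BH_bound[OF N] by blast
  \<comment> \<open>This s minimises the bound 1 - 2 s c^2 + s^2 K^2 for the squared contraction
    factor; the minimum is 1 - c^4 / K^2.\<close>
  define s where "s = c\<^sup>2 / K\<^sup>2"
  have s: "s > 0" using K c by (simp add: s_def)
  \<comment> \<open>The maximum with 0 covers the zero space, where c and K are unrelated and the
    second entry may be negative.\<close>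
  define r where "r = max 0 (1 - c^4 / K^2)"
  have r: "0 \<le> r" "r < 1" using K c by (auto simp: r_def)
  have contr: "norm (v - s *\<^sub>R N v) \<le> sqrt r * norm v" for v
  proof -
    have "(norm (v - s *\<^sub>R N v))\<^sup>2 = (norm v)\<^sup>2 - 2 * s * (norm (L v))\<^sup>2 + s\<^sup>2 * (norm (N v))\<^sup>2"
      using adj[of v] Re_cinner_commute[of v "N v"] s
      by (simp add: norm_sq_diff scaleR_scaleC cinner_scaleC_right norm_sq_cinner[of "L v"] power_mult_distrib)
    also have "\<dots> \<le> (norm v)\<^sup>2 - 2 * s * (c * norm v)\<^sup>2 + s\<^sup>2 * (K * norm v)\<^sup>2"
      using s c below[of v] K(2)[of v]
      by (intro add_mono diff_mono mult_left_mono power_mono) auto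
    also have "\<dots> = (1 - c^4 / K^2) * (norm v)\<^sup>2"
      using K by (simp add: s_def field_simps power2_eq_square eval_nat_numeral)
    also have "\<dots> \<le> r * (norm v)\<^sup>2" by (intro mult_right_mono) (auto simp: r_def)
    also have "\<dots> = (sqrt r * norm v)\<^sup>2" using r by (simp add: power_mult_distrib)
    finally show ?thesis by (rule power2_le_imp_le) (use r in auto)
  qed
  define f where "f = (\<lambda>v. v - s *\<^sub>R (N v - w))"
  have "dist (f u) (f v) \<le> sqrt r * dist u v" for u v
  proof -
    have "f u - f v = (u - v) - s *\<^sub>R N (u - v)"
      by (simp add: f_def clinear_opD[OF BH_clinear[OF N]] scaleR_diff_right)
    thus ?thesis using contr[of "u - v"] by (simp add: dist_norm)
  qed
  hence "\<exists>!v. f v = v" using r by (intro banach_fix_type[of "sqrt r"]) auto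
  then obtain v where "f v = v" by blast
  hence "N v = w" using s by (simp add: f_def)
  thus ?thesis by (intro exI[of _ "L v"]) (simp add: N_def L'_def)
qed

text \<open>The spectrum of a self-adjoint operator consists of approximate eigenvalues: outside the
  spectrum means no more than bounded below.\<close>

lemma self_adjoint_not_in_spectrumI:
  fixes T :: "'a::chilbert_space \<Rightarrow> 'a"
  assumes "self_adjoint T" "c > 0" "\<And>v. c * norm v \<le> norm (T v - l *\<^sub>C v)"
  shows "l \<notin> spectrum_BH T"
  using not_in_spectrumI[OF self_adjoint_BH[OF assms(1)] assms(2,3)]
    self_adjoint_bounded_below_surj[OF assms] by blast

text \<open>Since <T v, v> is real, the cross term vanishes in ||(T - l) v||^2 = ||(T - Re l) v||^2
  + (Im l)^2 ||v||^2, so a nonzero Im l bounds T - l below.\<close>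

lemma self_adjoint_spectrum_real:
  fixes T :: "'a::chilbert_space \<Rightarrow> 'a"
  assumes sa: "self_adjoint T" and l: "l \<in> spectrum_BH T"
  shows "Im l = 0"
proof (rule ccontr)
  assume "Im l \<noteq> 0"
  have "\<bar>Im l\<bar> * norm v \<le> norm (T v - l *\<^sub>C v)" for v
  proof -
    have "complex_of_real (Re l) *\<^sub>C v + \<i> *\<^sub>C (complex_of_real (Im l) *\<^sub>C v) = l *\<^sub>C v"
      unfolding scaleC_scaleC scaleC_add_left[symmetric] by (simp flip: complex_eq)
    hence split: "T v - l *\<^sub>C v = (T v - complex_of_real (Re l) *\<^sub>C v) - \<i> *\<^sub>C (complex_of_real (Im l) *\<^sub>C v)"
      by (metis diff_diff_eq)
    have "Im (cinner (T v) v) = 0"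
      using self_adjoint_cinner[OF sa, of v v] cinner_commute[of v "T v"] by (simp add: complex_eq_iff)
    hence "(norm (T v - l *\<^sub>C v))\<^sup>2 = (norm (T v - complex_of_real (Re l) *\<^sub>C v))\<^sup>2 + (\<bar>Im l\<bar> * norm v)\<^sup>2"
      unfolding split norm_sq_diff[of _ "\<i> *\<^sub>C _"]
      by (simp add: cinner_scaleC_right cinner_diff_left cinner_scaleC_left cinner_self_real)
    hence "(\<bar>Im l\<bar> * norm v)\<^sup>2 \<le> (norm (T v - l *\<^sub>C v))\<^sup>2" by simp
    thus ?thesis by (rule power2_le_imp_le) simp
  qed
  with self_adjoint_not_in_spectrumI[OF sa, of "\<bar>Im l\<bar>" l] \<open>Im l \<noteq> 0\<close> l show False by simp
qed

lemma self_adjoint_spectrum_bounded: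
  fixes T :: "'a::chilbert_space \<Rightarrow> 'a"
  assumes sa: "self_adjoint T"
  shows "bounded (spectrum_BH T)"
proof -
  obtain K where K: "K > 0" "\<And>v. norm (T v) \<le> K * norm v"
    using BH_bound[OF self_adjoint_BH[OF sa]] by blast
  have "cmod l \<le> K" if "l \<in> spectrum_BH T" for l
  proof (rule ccontr)
    assume "\<not> cmod l \<le> K"
    moreover have "(cmod l - K) * norm v \<le> norm (T v - l *\<^sub>C v)" for v
      using K(2)[of v] norm_triangle_ineq2[of "l *\<^sub>C v" "T v"]
      by (simp add: left_diff_distrib norm_minus_commute)
    ultimately show False
      using self_adjoint_not_in_spectrumI[OF sa, of "cmod l - K" l] that by simp
  qed
  thus ?thesis by (auto simp: bounded_iff)
qed

section \<open>Algebraic operators\<close>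

text \<open>Every spectral value l is a root of p. Otherwise p - p(l) = (X - l) q and p(T) = 0 show
  that -q(T) / p(l) is a two-sided bounded inverse of T - l.\<close>

lemma algebraic_op_finite_spectrum:
  assumes T: "T \<in> BH" and p: "p \<noteq> 0" "\<And>v. op_poly T p v = 0"
  shows "finite (spectrum_BH T)"
proof -
  have "poly p l = 0" if "l \<in> spectrum_BH T" for l
  proof (rule ccontr)
    assume nz: "poly p l \<noteq> 0"
    note lin = BH_clinear[OF T]
    obtain q where "p - [:poly p l:] = [:- l, 1:] * q"
      using poly_eq_0_iff_dvd[of "p - [:poly p l:]" l] by (auto elim: dvdE)
    hence q: "p - [:poly p l:] = q * [:- l, 1:]" "p - [:poly p l:] = [:- l, 1:] * q" by (simp_all add: mult.commute)
    have *: "op_poly T (p - [:poly p l:]) v = - poly p l *\<^sub>C v" for v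
      using p(2) by (simp add: op_poly_diff[OF lin] op_poly_pCons[OF lin] clinear_opD[OF lin] scaleC_minus_left)
    have shift: "op_poly T [:- l, 1:] v = T v - l *\<^sub>C v" for v
      by (simp add: op_poly_pCons[OF lin] clinear_opD[OF lin] scaleC_minus_left scaleC_one)
    define S where "S = (\<lambda>v. (- 1 / poly p l) *\<^sub>C op_poly T q v)"
    have "S \<in> BH" unfolding S_def by (intro BH_scaleC op_poly_BH T)
    moreover have "S (T v - l *\<^sub>C v) = v" for v
      using *[of v] nz unfolding q(1) op_poly_mult[OF lin] shift
      by (simp add: S_def scaleC_scaleC scaleC_one)
    moreover have "T (S v) - l *\<^sub>C S v = v" for v
    proof -
      have "T (S v) - l *\<^sub>C S v = (- 1 / poly p l) *\<^sub>C (T (op_poly T q v) - l *\<^sub>C op_poly T q v)"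
        by (simp only: S_def clinear_opD(2)[OF lin] scaleC_diff_right scaleC_scaleC mult.commute)
      also have "\<dots> = v"
        using *[of v] nz unfolding q(2) op_poly_mult[OF lin] shift by (simp add: scaleC_scaleC scaleC_one)
      finally show ?thesis .
    qed
    ultimately show False using that by (auto simp: spectrum_BH_def fun_eq_iff)
  qed
  hence "spectrum_BH T \<subseteq> {l. poly p l = 0}" by blast
  thus ?thesis using poly_roots_finite[OF p(1)] finite_subset by blast
qed

text \<open>The witness is ||R||^2, an approximate eigenvalue of R^2: a lower bound c for R^2 -
  ||R||^2 would force ||R||^2 \<le> ||R||^2 - c^2 / ||R||^2 or R = 0. Squaring R avoids deciding
  which of the two values ||R|| and -||R|| is attained.\<close>

lemma self_adjoint_not_bounded_below:
  fixes R :: "'a::cinner_space \<Rightarrow> 'a"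
  assumes sa: "self_adjoint R" and nz: "R v0 \<noteq> 0"
  obtains m where "m \<noteq> 0"
    "\<And>c. c > 0 \<Longrightarrow> \<exists>v. norm (R (R v) - complex_of_real m *\<^sub>C v) < c * norm v"
proof -
  have bl: "bounded_linear R" by (rule BH_bounded_linear[OF self_adjoint_BH[OF sa]])
  define m where "m = onorm R"
  have m: "m > 0"
    using onorm_pos_lt[OF bl] nz by (auto simp: m_def)
  have m_bound: "norm (R v) \<le> m * norm v" for v
    unfolding m_def by (rule onorm[OF bl])
  have "\<exists>v. norm (R (R v) - complex_of_real (m\<^sup>2) *\<^sub>C v) < c * norm v" if c: "c > 0" for c
  proof (rule ccontr)
    assume "\<not> ?thesis"
    hence below: "c * norm v \<le> norm (R (R v) - complex_of_real (m\<^sup>2) *\<^sub>C v)" for v by (auto simp: not_less)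
    define r where "r = max 0 (m\<^sup>2 - c\<^sup>2 / m\<^sup>2)"
    have r: "0 \<le> r" "r < m\<^sup>2" using c m by (auto simp: r_def)
    have "norm (R v) \<le> sqrt r * norm v" for v
    proof -
      have "(c * norm v)\<^sup>2 \<le> (norm (R (R v) - complex_of_real (m\<^sup>2) *\<^sub>C v))\<^sup>2"
        using below[of v] c by (intro power_mono) auto
      also have "\<dots> = (norm (R (R v)))\<^sup>2 - 2 * m\<^sup>2 * (norm (R v))\<^sup>2 + (m\<^sup>2 * norm v)\<^sup>2"
        using self_adjoint_cinner[OF sa, of "R v" v]
        by (simp add: norm_sq_diff cinner_scaleC_right norm_sq_cinner[of "R v"] power_mult_distrib norm_power
            flip: of_real_power)
      also have "\<dots> \<le> (m * norm (R v))\<^sup>2 - 2 * m\<^sup>2 * (norm (R v))\<^sup>2 + (m\<^sup>2 * norm v)\<^sup>2"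
        using m_bound[of "R v"] by (intro add_mono diff_mono power_mono) auto
      finally have "m\<^sup>2 * (norm (R v))\<^sup>2 \<le> (m^4 - c\<^sup>2) * (norm v)\<^sup>2"
        by (simp add: power_mult_distrib algebra_simps flip: power_mult)
      hence "(norm (R v))\<^sup>2 \<le> (m\<^sup>2 - c\<^sup>2 / m\<^sup>2) * (norm v)\<^sup>2"
        using m by (simp add: field_simps eval_nat_numeral)
      also have "\<dots> \<le> r * (norm v)\<^sup>2" by (intro mult_right_mono) (auto simp: r_def)
      also have "\<dots> = (sqrt r * norm v)\<^sup>2" using r by (simp add: power_mult_distrib)
      finally show ?thesis by (rule power2_le_imp_le) (use r in auto)
    qed
    hence "m \<le> sqrt r" unfolding m_def using r by (intro onorm_bound) auto
    hence "m\<^sup>2 \<le> r" using m r by (metis less_eq_real_def power_mono real_sqrt_pow2)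
    thus False using r by simp
  qed
  thus ?thesis using m by (intro that[of "m\<^sup>2"]) auto
qed

lemma map_poly_cnj_mult: "map_poly cnj (p * q) = map_poly cnj p * map_poly cnj q"
  by (intro poly_eqI) (simp add: coeff_map_poly coeff_mult cnj_sum)

lemma map_poly_cnj_cnj [simp]: "map_poly cnj (map_poly cnj p) = p"
  by (intro poly_eqI) (simp add: coeff_map_poly)

lemma map_poly_cnj_eq_0_iff [simp]: "map_poly cnj p = 0 \<longleftrightarrow> p = 0"
  by (metis map_poly_0 map_poly_cnj_cnj)

text \<open>Over the complex numbers p splits into linear factors, and each T - l with l outside the
  spectrum is bounded below; the lower bounds multiply.\<close>

lemma op_poly_bounded_below:
  assumes T: "T \<in> BH" and "p \<noteq> 0" "\<And>l. poly p l = 0 \<Longrightarrow> l \<notin> spectrum_BH T"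
  obtains c where "c > 0" "\<And>v. c * norm v \<le> norm (op_poly T p v)"
  using assms(2,3)
proof (induction "degree p" arbitrary: p thesis)
  case 0
  then obtain a where p: "p = [:a:]" "a \<noteq> 0" by (auto elim!: degree_eq_zeroE)
  thus ?case using 0(2)[of "cmod a"]
    by (simp add: op_poly_pCons[OF BH_clinear[OF T]] clinear_opD[OF BH_clinear[OF T]])
next
  case (Suc n p)
  note lin = BH_clinear[OF T]
  obtain l where l: "poly p l = 0"
    using fundamental_theorem_of_algebra[of p] Suc(2) constant_degree[of p] by auto
  then obtain q where q: "p = [:- l, 1:] * q" unfolding poly_eq_0_iff_dvd by (rule dvdE)
  have "q \<noteq> 0" using Suc q by auto
  hence "degree q = n" using Suc(2) by (simp add: q degree_mult_eq del: mult_pCons_left)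
  obtain c where c: "c > 0" "\<And>v. c * norm v \<le> norm (op_poly T q v)"
    using Suc(1)[of q] \<open>degree q = n\<close> \<open>q \<noteq> 0\<close> Suc(5) q by (metis mult_zero_right poly_mult)
  obtain d where d: "d > 0" "\<And>v. d * norm v \<le> norm (T v - l *\<^sub>C v)"
    using spectrum_bounded_below[OF T Suc(5)[OF l]] by blast
  have "d * c * norm v \<le> norm (op_poly T p v)" for v
  proof -
    have "d * (c * norm v) \<le> d * norm (op_poly T q v)" using c d by simp
    also have "\<dots> \<le> norm (T (op_poly T q v) - l *\<^sub>C op_poly T q v)" by (rule d)
    also have "\<dots> = norm (op_poly T p v)"
      unfolding q op_poly_mult[OF lin]
      by (simp add: op_poly_pCons[OF lin] clinear_opD[OF lin] scaleC_minus_left scaleC_one)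
    finally show ?thesis by (simp add: mult.assoc)
  qed
  thus ?case using Suc(3)[of "d * c"] c d by simp
qed

text \<open>Take p with real coefficients vanishing on the spectrum. If p(T) were nonzero, some m
  \<noteq> 0 would leave p(T)^2 - m not bounded below; but p^2 - m equals -m on the spectrum, so it
  has no root there and p(T)^2 - m is bounded below.\<close>

lemma self_adjoint_finite_spectrum_algebraic:
  assumes sa: "self_adjoint T" and fin: "finite (spectrum_BH T)"
  shows "algebraic_op T"
proof -
  note lin = BH_clinear[OF self_adjoint_BH[OF sa]]
  define q where "q = (\<Prod>l\<in>spectrum_BH T. [:- l, 1:])"
  have q: "q \<noteq> 0" "\<And>l. l \<in> spectrum_BH T \<Longrightarrow> poly q l = 0"
    using fin by (auto simp: q_def poly_prod)
  \<comment> \<open>Multiplying \<open>q\<close> by its conjugate makes the coefficients real, hence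
    p(T) self-adjoint. The factor X gives P(0) = -m below, so that \<open>P\<close> is nonzero even
    for an empty spectrum.\<close>
  define p where "p = [:0, 1:] * (q * map_poly cnj q)"
  have p: "p \<noteq> 0" "map_poly cnj p = p" "\<And>l. l \<in> spectrum_BH T \<Longrightarrow> poly p l = 0"
    using q by (simp_all add: p_def map_poly_cnj_mult map_poly_pCons mult.commute)
  have sa': "self_adjoint (op_poly T p)"
    using op_poly_BH[OF self_adjoint_BH[OF sa]] op_poly_adjoint[OF sa, of p] p(2)
    by (simp add: self_adjoint_def)
  have "op_poly T p v = 0" for v
  proof (rule ccontr)
    assume "op_poly T p v \<noteq> 0"
    then obtain m where m: "m \<noteq> 0"
      "\<And>c. c > 0 \<Longrightarrow> \<exists>v. norm (op_poly T p (op_poly T p v) - complex_of_real m *\<^sub>C v) < c * norm v"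
      using self_adjoint_not_bounded_below[OF sa'] by metis
    define P where "P = p * p - [:complex_of_real m:]"
    have P: "op_poly T P v = op_poly T p (op_poly T p v) - complex_of_real m *\<^sub>C v" for v
      by (simp add: P_def op_poly_diff[OF lin] op_poly_mult[OF lin] op_poly_pCons[OF lin] clinear_opD[OF lin])
    have "l \<notin> spectrum_BH T" if "poly P l = 0" for l
      using that p(3)[of l] m(1) by (auto simp: P_def)
    moreover have "P \<noteq> 0"
    proof
      assume "P = 0"
      hence "poly P 0 = 0" by simp
      thus False using m(1) by (simp add: P_def p_def)
    qed
    ultimately obtain c where "c > 0" "\<And>v. c * norm v \<le> norm (op_poly T P v)"
      using op_poly_bounded_below[OF self_adjoint_BH[OF sa]] by blast
    thus False using m(2)[of c] by (auto simp: P not_less[symmetric])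
  qed
  thus ?thesis using p(1) by (auto simp: algebraic_op_def)
qed

section \<open>Closed range\<close>

text \<open>If the estimate fails, there are unit vectors \<open>u n\<close> in the range with \<open>S (u n)\<close> of norm below
  \<open>(1/4)^n\<close>. A signed series \<open>\<Sum>n. \<plusminus> (1/3)^n u n\<close> converges to some \<open>S z\<close>, and the signs can be
  chosen such that its inner product with each \<open>u n\<close> has size at least \<open>(1/3)^n / 2\<close>, which
  contradicts \<open>\<langle>u n, S z\<rangle> = \<langle>S (u n), z\<rangle>\<close>.\<close>

lemma self_adjoint_closed_range_bound:
  fixes S :: "'a::chilbert_space \<Rightarrow> 'a"
  assumes sa: "self_adjoint S" and cl: "closed (range S)"
  obtains c where "c > 0" "\<And>v. c * norm (S v) \<le> norm (S (S v))"
proof -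
  note lin = clinear_opD[OF BH_clinear[OF self_adjoint_BH[OF sa]]]
  have scaleR: "S (r *\<^sub>R x) = r *\<^sub>R S x" for r x by (simp add: scaleR_scaleC lin)
  have "\<exists>c>0. \<forall>v. c * norm (S v) \<le> norm (S (S v))"
  proof (rule ccontr)
    assume neg: "\<not> ?thesis"
    have "\<exists>u\<in>range S. norm u = 1 \<and> norm (S u) \<le> (1/4)^n" for n
    proof -
      obtain v where v: "norm (S (S v)) < (1/4)^n * norm (S v)"
        using neg by (meson not_le zero_less_divide_1_iff zero_less_numeral zero_less_power)
      hence nz: "norm (S v) > 0" by (cases "S v = 0") auto
      show ?thesis
      proof (intro bexI[of _ "S ((1 / norm (S v)) *\<^sub>R v)"] conjI)
        show "norm (S ((1 / norm (S v)) *\<^sub>R v)) = 1" using nz by (simp add: scaleR)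
        show "norm (S (S ((1 / norm (S v)) *\<^sub>R v))) \<le> (1/4)^n"
          using nz v by (simp add: scaleR field_simps)
      qed auto
    qed
    then obtain u where u: "\<And>n. u n \<in> range S" "\<And>n. norm (u n) = 1" "\<And>n. norm (S (u n)) \<le> (1/4)^n"
      by metis
    \<comment> \<open>The sign of each new term agrees with that of Re <u n, y n>, so the term adds
      its full size (1/3)^n to the absolute value of that real part.\<close>
    define y where "y = rec_nat 0 (\<lambda>n y. if Re (cinner (u n) y) \<ge> 0
        then y + (1/3)^n *\<^sub>R u n else y - (1/3)^n *\<^sub>R u n)"
    have y: "y 0 = 0" "\<And>n. y (Suc n) = (if Re (cinner (u n) (y n)) \<ge> 0
        then y n + (1/3)^n *\<^sub>R u n else y n - (1/3)^n *\<^sub>R u n)"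
      by (simp_all add: y_def)
    have range: "y n \<in> range S" for n
    proof (induction n)
      case 0
      show ?case using lin(3) by (auto simp: y intro: range_eqI[of _ _ 0])
    next
      case (Suc n)
      from Suc u(1)[of n] obtain a b where ab: "y n = S a" "u n = S b" by auto
      have "y n + (1/3)^n *\<^sub>R u n = S (a + (1/3)^n *\<^sub>R b)" "y n - (1/3)^n *\<^sub>R u n = S (a - (1/3)^n *\<^sub>R b)"
        by (simp_all add: ab scaleR lin)
      thus ?case unfolding y(2) by auto
    qed
    have large: "\<bar>Re (cinner (u n) (y (Suc n)))\<bar> \<ge> (1/3)^n" for n
      using u(2)[of n] zero_le_power[of "1/3 :: real" n]
      by (auto simp: y cinner_add_right cinner_diff_right scaleR_scaleC cinner_scaleC_right
          cinner_self simp del: of_real_power)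
    \<comment> \<open>r n is the geometric tail of (1/3)^k over k \<ge> n. In particular r (n + 1) =
      (1/3)^n / 2, so the terms after the n-th can destroy at most half of the size secured by
      \<open>large\<close>.\<close>
    define r :: "nat \<Rightarrow> real" where "r = (\<lambda>n. 3/2 * (1/3)^n)"
    have step: "norm (y (n + k) - y n) \<le> r n - r (n + k)" for n k
    proof (induction k)
      case (Suc k)
      have "norm (y (n + Suc k) - y (n + k)) = (1/3)^(n+k)"
        using u(2)[of "n + k"] by (simp add: y)
      moreover have "(1/3)^(n+k) = r (n + k) - r (n + Suc k)" by (simp add: r_def)
      ultimately show ?case
        using Suc norm_triangle_ineq[of "y (n + Suc k) - y (n + k)" "y (n + k) - y n"] by simp
    qed simp
    have tail: "norm (y m - y n) \<le> r n" if "n \<le> m" for m n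
    proof -
      have "r m \<ge> 0" by (simp add: r_def)
      thus ?thesis using step[of n "m - n"] that by simp
    qed
    have "r \<longlonglongrightarrow> 0" unfolding r_def by (intro tendsto_mult_right_zero LIMSEQ_realpow_zero) auto
    have "Cauchy y"
    proof (rule metric_CauchyI)
      fix e :: real assume "e > 0"
      with \<open>r \<longlonglongrightarrow> 0\<close> have "eventually (\<lambda>n. r n < e / 2) sequentially"
        by (intro order_tendstoD) auto
      then obtain N where N: "r N < e / 2" by (auto simp: eventually_sequentially)
      show "\<exists>M. \<forall>m\<ge>M. \<forall>n\<ge>M. dist (y m) (y n) < e"
      proof (intro exI allI impI)
        fix m n assume "m \<ge> N" "n \<ge> N"
        thus "dist (y m) (y n) < e"
          using tail[of N m] tail[of N n] N dist_triangle3[of "y m" "y n" "y N"]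
          by (simp add: dist_norm norm_minus_commute)
      qed
    qed
    then obtain z' where lim: "y \<longlonglongrightarrow> z'" using Cauchy_convergent convergent_def by blast
    hence "z' \<in> range S" using cl range closed_sequentially by blast
    then obtain z where z: "z' = S z" by blast
    have bound: "(4/3)^n \<le> 2 * norm z" for n
    proof -
      have "norm (z' - y (Suc n)) \<le> r (Suc n)"
        by (rule LIMSEQ_le_const2[OF tendsto_norm[OF tendsto_diff[OF lim tendsto_const]]])
          (use tail in blast)
      hence small: "\<bar>Re (cinner (u n) (z' - y (Suc n)))\<bar> \<le> (1/3)^n / 2"
        using abs_Re_cinner_le[of "u n" "z' - y (Suc n)"] u(2)[of n] by (simp add: r_def)
      have "\<bar>Re (cinner (u n) z')\<bar> \<le> norm (S (u n)) * norm z"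
        using abs_Re_cinner_le[of "S (u n)" z] self_adjoint_cinner[OF sa, of "u n" z] by (simp add: z)
      also have "\<dots> \<le> (1/4)^n * norm z" by (intro mult_right_mono u(3)) auto
      finally have "(1/3)^n / 2 \<le> (1/4)^n * norm z"
        using large[of n] small unfolding cinner_diff_right minus_complex.simps by linarith
      thus ?thesis by (simp add: field_simps power_divide)
    qed
    obtain n where "2 * norm z < (4/3)^n" using real_arch_pow[of "4/3" "2 * norm z"] by auto
    with bound[of n] show False by simp
  qed
  thus ?thesis using that by blast
qed

text \<open>Closed range of S = T (T - a) would give c > 0 with c ||S v|| \<le> ||S (S v)||, and
  then S - k is bounded below whenever 0 < |k| < c. Spectral points m of T near a supply such k =
  p(m), while S - k = q(T) (T - m) passes the lower bound on to T - m.\<close>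

lemma infinite_spectrum_not_closed_range:
  fixes T :: "'a::chilbert_space \<Rightarrow> 'a"
  assumes sa: "self_adjoint T" and inf: "infinite (spectrum_BH T)"
  obtains a where "self_adjoint (op_poly T [:0, - complex_of_real a, 1:])"
    "\<not> closed (range (op_poly T [:0, - complex_of_real a, 1:]))"
proof -
  note BH = self_adjoint_BH[OF sa]
  note lin = BH_clinear[OF BH]
  obtain l where l: "l islimpt spectrum_BH T"
    using bounded_infinite_imp_islimpt[OF subset_refl self_adjoint_spectrum_bounded[OF sa] inf] by blast
  define a where "a = Re l"
  have "spectrum_BH T \<subseteq> {z. Im z = 0}" using self_adjoint_spectrum_real[OF sa] by auto
  hence "l islimpt {z. Im z = 0}" using l islimpt_subset by blast
  moreover have "closed {z. Im z = 0}" by (intro closed_Collect_eq continuous_intros)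
  ultimately have la: "l = complex_of_real a" by (auto simp: a_def closed_limpt complex_eq_iff)
  define p where "p = [:0, - complex_of_real a, 1:]"
  define S where "S = op_poly T p"
  have cnj_p: "map_poly cnj p = p" by (simp add: p_def map_poly_pCons)
  have sa': "self_adjoint S"
    using op_poly_BH[OF BH] op_poly_adjoint[OF sa, of p] cnj_p by (simp add: self_adjoint_def S_def)
  have "\<not> closed (range S)"
  proof
    assume "closed (range S)"
    then obtain c where c: "c > 0" "\<And>v. c * norm (S v) \<le> norm (S (S v))"
      using self_adjoint_closed_range_bound[OF sa'] by blast
    have "isCont (\<lambda>z. cmod (poly p z)) l" by (intro continuous_intros)
    hence "((\<lambda>z. cmod (poly p z)) \<longlongrightarrow> 0) (at l)" by (simp add: isCont_def p_def la)
    hence "eventually (\<lambda>z. cmod (poly p z) < c) (at l)" by (rule order_tendstoD) (rule c)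
    then obtain d where d: "d > 0" "\<And>z. z \<noteq> l \<Longrightarrow> dist z l < d \<Longrightarrow> cmod (poly p z) < c"
      unfolding eventually_at by auto
    \<comment> \<open>Removing the finitely many roots of p leaves a spectral point m near l with 0
      < |p(m)| < c.\<close>
    have "infinite (spectrum_BH T \<inter> ball l d)" using l d(1) islimpt_eq_infinite_ball by blast
    moreover have "finite {z. poly p z = 0}" by (rule poly_roots_finite) (simp add: p_def)
    ultimately have "infinite ((spectrum_BH T \<inter> ball l d) - {z. poly p z = 0})"
      by (rule Diff_infinite_finite[rotated])
    hence "(spectrum_BH T \<inter> ball l d) - {z. poly p z = 0} \<noteq> {}" by (rule infinite_imp_nonempty)
    then obtain m where m: "m \<in> spectrum_BH T" "m \<in> ball l d" "poly p m \<noteq> 0" by blast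
    have "m \<noteq> l" using m(3) by (auto simp: p_def la)
    hence pm: "cmod (poly p m) < c" using d(2) m(2) by (simp add: dist_commute)
    define k where "k = poly p m"
    have "poly (p - [:k:]) m = 0" by (simp add: k_def)
    then obtain q where "p - [:k:] = [:- m, 1:] * q" unfolding poly_eq_0_iff_dvd by (rule dvdE)
    hence q: "p - [:k:] = q * [:- m, 1:]" by (simp only: mult.commute)
    have factor: "S v - k *\<^sub>C v = op_poly T q (T v - m *\<^sub>C v)" for v
    proof -
      have "op_poly T (p - [:k:]) v = S v - k *\<^sub>C v"
        by (simp add: S_def op_poly_diff[OF lin] op_poly_pCons[OF lin] clinear_opD[OF lin])
      moreover have "op_poly T [:- m, 1:] v = T v - m *\<^sub>C v"
        by (simp add: op_poly_pCons[OF lin] clinear_opD[OF lin] scaleC_minus_left scaleC_one)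
      ultimately show ?thesis unfolding q op_poly_mult[OF lin] by simp
    qed
    obtain K where K: "K > 0" "\<And>v. norm (op_poly T q v) \<le> K * norm v"
      using BH_bound[OF op_poly_BH[OF BH]] by blast
    obtain M where M: "M > 0" "\<And>v. norm (S v) \<le> M * norm v"
      using BH_bound[OF self_adjoint_BH[OF sa']] by blast
    define e where "e = c - cmod k"
    have e: "e > 0" "cmod k > 0" using pm m(3) by (auto simp: e_def k_def)
    \<comment> \<open>With w = (S - k) v, the estimate for S on its range gives e ||S v|| \<le> ||S
      w|| \<le> M ||w||; it is combined with |k| ||v|| \<le> ||S v|| + ||w||.\<close>
    have *: "norm v * (cmod k * e) \<le> (M + e) * norm (S v - k *\<^sub>C v)" for v
    proof -
      define w where "w = S v - k *\<^sub>C v"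
      have Sw: "S w = S (S v) - k *\<^sub>C S v"
        by (simp add: w_def clinear_opD[OF BH_clinear[OF self_adjoint_BH[OF sa']]])
      have "e * norm (S v) \<le> norm (S w)"
        using c(2)[of v] norm_triangle_ineq2[of "S (S v)" "k *\<^sub>C S v"]
        by (simp add: Sw e_def left_diff_distrib)
      also have "\<dots> \<le> M * norm w" by (rule M)
      finally have 1: "e * norm (S v) \<le> M * norm w" .
      have "cmod k * norm v \<le> norm (S v) + norm w"
        using norm_triangle_ineq4[of "S v" w] by (simp add: w_def)
      hence "e * (cmod k * norm v) \<le> e * (norm (S v) + norm w)" using e by simp
      thus ?thesis using 1 by (simp add: algebra_simps w_def)
    qed
    have "(cmod k * e) / ((M + e) * K) * norm v \<le> norm (T v - m *\<^sub>C v)" for v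
    proof -
      have "norm v * (cmod k * e) \<le> (M + e) * (K * norm (T v - m *\<^sub>C v))"
        using M(1) e by (intro order.trans[OF *[of v, unfolded factor]] mult_left_mono K(2)) simp
      moreover have "(M + e) * K > 0" using M(1) e K(1) by simp
      ultimately show ?thesis by (simp add: pos_divide_le_eq mult_ac)
    qed
    hence "m \<notin> spectrum_BH T"
      using M(1) e K(1) by (intro self_adjoint_not_in_spectrumI[OF sa, of "(cmod k * e) / ((M + e) * K)"]) auto
    thus False using m by simp
  qed
  thus ?thesis using that sa' by (simp add: S_def p_def)
qed

text \<open>x y is a continuous idempotent with the same range as x, so this range is its set of
  fixed points.\<close>

lemma quasi_inverse_closed_range:
  assumes x: "x \<in> BH" and y: "y \<in> BH" and "x \<circ> y \<circ> x = x"
  shows "closed (range x)"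
proof -
  have "x (y (x v)) = x v" for v using fun_cong[OF assms(3), of v] by simp
  hence "range x = {v. x (y v) = v}" by (auto intro: range_eqI[OF sym])
  moreover have "continuous_on UNIV (x \<circ> y)"
    using BH_bounded_linear[OF BH_comp[OF x y]] by (rule linear_continuous_on)
  hence "closed {v. x (y v) = v}"
    by (intro closed_Collect_eq) (auto simp: comp_def intro: continuous_on_id)
  ultimately show ?thesis by simp
qed

section \<open>Regularity\<close>

text \<open>||h u||^2 = <u, h (h u)>, so h (h u) = 0 already gives h u = 0; the exponent is lowered
  one step at a time.\<close>

lemma self_adjoint_funpow_eq_0:
  assumes sa: "self_adjoint h" and "(h ^^ Suc n) w = 0"
  shows "h w = 0"
  using assms(2)
proof (induction n)
  case (Suc n)
  let ?u = "(h ^^ n) w"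
  have "cinner (h ?u) (h ?u) = cinner ?u (h (h ?u))" by (rule self_adjoint_cinner[OF sa])
  also have "\<dots> = 0" using Suc.prems by simp
  finally have "h ?u = 0" by (simp only: cinner_self_eq_zero)
  thus ?case using Suc.IH by simp
qed simp

text \<open>Split off the power of X: p = X^n r with r = a + X s and a \<noteq> 0. Powers of h have
  no larger kernel than h, so h r(h) = 0, that is h^2 s(h) = -a h, and q = -s / a works.\<close>

lemma self_adjoint_algebraic_quasi_inverse:
  assumes sa: "self_adjoint h" and alg: "algebraic_op h"
  obtains q where "\<And>v. h (op_poly h q (h v)) = h v"
proof -
  note lin = BH_clinear[OF self_adjoint_BH[OF sa]]
  obtain p where p: "p \<noteq> 0" "\<And>v. op_poly h p v = 0" using alg by (auto simp: algebraic_op_def)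
  obtain r where r: "p = [:- 0, 1:] ^ order 0 p * r" "\<not> [:- 0, 1:] dvd r"
    using order_decomp[OF p(1), of 0] by blast
  define n where "n = order 0 p"
  have p_eq: "p = monom 1 n * r"
    using r(1) by (simp add: n_def monom_altdef)
  obtain a s where s: "r = pCons a s" by (cases r)
  have a: "a \<noteq> 0" using r(2) s poly_eq_0_iff_dvd[of r 0] by auto
  have "h (op_poly h r v) = 0" for v
  proof -
    have "(h ^^ n) (op_poly h r v) = 0"
      using p(2)[of v] by (simp add: p_eq op_poly_mult[OF lin] op_poly_monom[OF lin] scaleC_one)
    \<comment> \<open>One extra power of h covers the case n = 0.\<close>
    hence "(h ^^ Suc n) (op_poly h r v) = 0" by (simp add: clinear_opD[OF lin])
    thus ?thesis by (rule self_adjoint_funpow_eq_0[OF sa])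
  qed
  hence hr: "h (h (op_poly h s v)) = - a *\<^sub>C h v" for v
    unfolding s by (simp add: op_poly_pCons[OF lin] clinear_opD[OF lin] scaleC_minus_left eq_neg_iff_add_eq_0 add.commute)
  have "h (op_poly h (smult (- 1 / a) s) (h v)) = h v" for v
    unfolding op_poly_smult[OF lin] op_poly_commute[OF lin] clinear_opD(2)[OF lin] hr
    by (simp add: scaleC_scaleC a scaleC_one)
  thus ?thesis by (rule that)
qed

text \<open>With \<open>s\<close> the adjoint of x, the kernel of h = s x equals that of x. Hence h
  q(h) h = h can be cancelled to x q(h) s x = x, and q(h) s lies in \<open>A\<close> because its
  right factor does.\<close>

lemma algebraic_imp_regular:
  assumes A: "star_subalgebra_BH A" and alg: "\<And>h. h \<in> A \<Longrightarrow> self_adjoint h \<Longrightarrow> algebraic_op h"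
    and x: "x \<in> A"
  shows "\<exists>y\<in>A. x \<circ> y \<circ> x = x"
proof -
  have sub: "subalgebra_BH A" using A by (simp add: star_subalgebra_BH_def)
  obtain s where s: "s \<in> A" "is_adjoint s x" using A x by (auto simp: star_subalgebra_BH_def)
  have adj: "cinner (x u) v = cinner u (s v)" "cinner (s u) v = cinner u (x v)" for u v
    using s(2) cinner_commute[of "s u" v] cinner_commute[of u "x v"] by (auto simp: is_adjoint_def)
  define h where "h = s \<circ> x"
  have hA: "h \<in> A" using sub s x by (simp add: h_def subalgebra_BH_def)
  moreover have "A \<subseteq> BH" using sub by (simp add: subalgebra_BH_def)
  ultimately have sa: "self_adjoint h" by (auto simp: self_adjoint_def h_def adj)
  obtain q where q: "\<And>v. h (op_poly h q (h v)) = h v"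
    using self_adjoint_algebraic_quasi_inverse[OF sa alg[OF hA sa]] by blast
  note xlin = clinear_opD[OF BH_clinear[of x]] and hlin = clinear_opD[OF BH_clinear[of h]]
  have "x (op_poly h q (s (x v))) = x v" for v
  proof -
    let ?w = "op_poly h q (h v) - v"
    have "cinner (x ?w) (x ?w) = cinner ?w (h ?w)" by (simp add: adj h_def)
    also have "h ?w = 0" using hA \<open>A \<subseteq> BH\<close> q by (simp add: hlin subsetD)
    finally have "x ?w = 0" by (simp add: cinner_self_eq_zero)
    thus ?thesis using x \<open>A \<subseteq> BH\<close> by (simp add: xlin subsetD h_def)
  qed
  hence "x \<circ> (op_poly h q \<circ> s) \<circ> x = x" by (simp add: fun_eq_iff)
  moreover have "op_poly h q \<circ> s \<in> A" by (rule op_poly_comp_in_subalgebra[OF sub hA s(1)])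
  ultimately show ?thesis by blast
qed

section \<open>Algebraicity along a pencil\<close>

text \<open>Fraction-free Gaussian elimination on the columns \<open>f 0, \<dots>, f (n - 1)\<close>.\<close>

lemma poly_family_dependent_or_generically_independent:
  fixes f :: "nat \<Rightarrow> 'i \<Rightarrow> 'b::idom poly"
  shows "(\<exists>c. (\<exists>j<n. c j \<noteq> 0) \<and> (\<forall>i. (\<Sum>j<n. c j * f j i) = 0)) \<or>
    (\<exists>d. d \<noteq> 0 \<and> (\<forall>t. poly d t \<noteq> 0 \<longrightarrow>
       (\<forall>a. (\<forall>i. (\<Sum>j<n. a j * poly (f j i) t) = 0) \<longrightarrow> (\<forall>j<n. a j = 0))))"
proof (induction n arbitrary: f)
  case 0
  show ?case by (intro disjI2 exI[of _ 1]) auto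
next
  case (Suc n)
  show ?case
  proof (cases "\<forall>i. f n i = 0")
    case True
    thus ?thesis by (intro disjI1 exI[of _ "\<lambda>j. if j = n then 1 else 0"]) auto
  next
    case False
    then obtain i0 where g: "f n i0 \<noteq> 0" by blast
    \<comment> \<open>Cross-multiplication with the pivot \<open>f n i0\<close> clears row
      \<open>i0\<close> without division.\<close>
    define f' where "f' j i = f n i0 * f j i - f j i0 * f n i" for j i
    from Suc[of f'] show ?thesis
    proof (elim disjE exE conjE)
      fix c j assume c: "\<forall>i. (\<Sum>j<n. c j * f' j i) = 0" and j: "j < n" "c j \<noteq> 0"
      \<comment> \<open>Expanding a relation among the \<open>f' j\<close> gives f n i0 times the
        sum of the c j * f j, minus a multiple of column n; the coefficient of column n is read off
        from row \<open>i0\<close>.\<close>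
      define c' where "c' j = (if j = n then - (\<Sum>j<n. c j * f j i0) else f n i0 * c j)" for j
      have "(\<Sum>j<Suc n. c' j * f j i) = (\<Sum>j<n. c j * f' j i)" for i
        by (simp add: c'_def f'_def sum_distrib_right sum_distrib_left sum_subtractf algebra_simps)
      thus ?thesis using c j g by (intro disjI1 exI[of _ c'] conjI exI[of _ j]) (auto simp: c'_def)
    next
      fix d assume d: "d \<noteq> 0" "\<forall>t. poly d t \<noteq> 0 \<longrightarrow>
        (\<forall>a. (\<forall>i. (\<Sum>j<n. a j * poly (f' j i) t) = 0) \<longrightarrow> (\<forall>j<n. a j = 0))"
      have "\<forall>j<Suc n. a j = 0"
        \<comment> \<open>Independence of the reduced columns at t lifts to the original ones as
          long as the pivot does not vanish at t either, hence the extra factor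
          \<open>f n i0\<close>.\<close>
        if t: "poly (d * f n i0) t \<noteq> 0" and a: "\<forall>i. (\<Sum>j<Suc n. a j * poly (f j i) t) = 0" for t a
      proof -
        let ?g = "poly (f n i0) t"
        have a': "(\<Sum>j<n. a j * poly (f j i) t) = - a n * poly (f n i) t" for i
          using a[rule_format, of i] by (simp add: eq_neg_iff_add_eq_0)
        have "(\<Sum>j<n. a j * poly (f' j i) t)
            = ?g * (\<Sum>j<n. a j * poly (f j i) t) - (\<Sum>j<n. a j * poly (f j i0) t) * poly (f n i) t" for i
          by (simp add: f'_def sum_distrib_right sum_distrib_left sum_subtractf algebra_simps)
        hence "(\<Sum>j<n. a j * poly (f' j i) t) = 0" for i by (simp add: a')
        hence 0: "\<forall>j<n. a j = 0" using d(2) t by auto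
        with a'[of i0] t have "a n = 0" by simp
        with 0 show ?thesis by (auto simp: less_Suc_eq)
      qed
      thus ?thesis using d(1) g by (intro disjI2 exI[of _ "d * f n i0"]) auto
    qed
  qed
qed

text \<open>A relation whose coefficients all vanish at t would evaluate to the trivial one. Such a
  relation is divisible by X - t, and each division lowers the degree of a fixed nonzero
  coefficient, so the process stops.\<close>

lemma poly_relation_primitive_at:
  fixes f :: "nat \<Rightarrow> 'i \<Rightarrow> 'b::idom poly"
  assumes "\<exists>j<n. c j \<noteq> 0" "\<forall>i. (\<Sum>j<n. c j * f j i) = 0"
  shows "\<exists>c'. (\<exists>j<n. poly (c' j) t \<noteq> 0) \<and> (\<forall>i. (\<Sum>j<n. c' j * f j i) = 0)"
proof -
  obtain j0 where "j0 < n" "c j0 \<noteq> 0" using assms by blast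
  with assms(2) show ?thesis
  proof (induction "degree (c j0)" arbitrary: c rule: less_induct)
    case less
    show ?case
    proof (cases "\<exists>j<n. poly (c j) t \<noteq> 0")
      case False
      hence "\<forall>j. \<exists>q. j < n \<longrightarrow> c j = [:- t, 1:] * q" unfolding poly_eq_0_iff_dvd by (meson dvdE)
      then obtain q where q: "\<And>j. j < n \<Longrightarrow> c j = [:- t, 1:] * q j" by metis
      have "[:- t, 1:] * (\<Sum>j<n. q j * f j i) = (\<Sum>j<n. c j * f j i)" for i
        unfolding sum_distrib_left by (rule sum.cong) (simp_all only: q lessThan_iff mult.assoc)
      hence "[:- t, 1:] * (\<Sum>j<n. q j * f j i) = 0" for i using less.prems(1) by metis
      hence "\<forall>i. (\<Sum>j<n. q j * f j i) = 0" by (simp del: mult_pCons_left)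
      moreover have "q j0 \<noteq> 0" using q[OF less.prems(2)] less.prems(3) by auto
      moreover from this have "degree (q j0) < degree (c j0)"
        unfolding q[OF less.prems(2)] by (subst degree_mult_eq) auto
      ultimately show ?thesis using less.hyps less.prems(2) by blast
    qed (use less.prems in blast)
  qed
qed

text \<open>Generic independence would make every element of \<open>X\<close> a root of one nonzero
  polynomial. So there is a relation with polynomial coefficients, which can be chosen nontrivial at
  t.\<close>

lemma poly_family_dependent_at:
  fixes f :: "nat \<Rightarrow> 'i \<Rightarrow> 'b::idom poly"
  assumes inf: "infinite X"
    and dep: "\<And>t. t \<in> X \<Longrightarrow> \<exists>a. (\<exists>j<n. a j \<noteq> 0) \<and> (\<forall>i. (\<Sum>j<n. a j * poly (f j i) t) = 0)"
  shows "\<exists>a. (\<exists>j<n. a j \<noteq> 0) \<and> (\<forall>i. (\<Sum>j<n. a j * poly (f j i) t) = 0)"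
  using poly_family_dependent_or_generically_independent[of n f]
proof
  assume "\<exists>c. (\<exists>j<n. c j \<noteq> 0) \<and> (\<forall>i. (\<Sum>j<n. c j * f j i) = 0)"
  then obtain c0 where c0: "\<exists>j<n. c0 j \<noteq> 0" "\<forall>i. (\<Sum>j<n. c0 j * f j i) = 0" by blast
  obtain c where c: "\<exists>j<n. poly (c j) t \<noteq> 0" "\<forall>i. (\<Sum>j<n. c j * f j i) = 0"
    using poly_relation_primitive_at[OF c0, of t] by blast
  have "(\<Sum>j<n. poly (c j) t * poly (f j i) t) = 0" for i
    using arg_cong[OF c(2)[rule_format, of i], of "\<lambda>p. poly p t"] by (simp add: poly_sum)
  thus ?thesis using c(1) by (intro exI[of _ "\<lambda>j. poly (c j) t"]) auto
next
  assume "\<exists>d. d \<noteq> 0 \<and> (\<forall>t. poly d t \<noteq> 0 \<longrightarrow>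
       (\<forall>a. (\<forall>i. (\<Sum>j<n. a j * poly (f j i) t) = 0) \<longrightarrow> (\<forall>j<n. a j = 0)))"
  then obtain d where d: "d \<noteq> 0" "\<forall>t. poly d t \<noteq> 0 \<longrightarrow>
       (\<forall>a. (\<forall>i. (\<Sum>j<n. a j * poly (f j i) t) = 0) \<longrightarrow> (\<forall>j<n. a j = 0))" by blast
  have "X \<subseteq> {t. poly d t = 0}" using dep d(2) by fast
  with inf poly_roots_finite[OF d(1)] show ?thesis using finite_subset by blast
qed

text \<open>The matrix coefficient <u, (a + t b)^n v> as a polynomial in t; the recursion peels off
  the factor next to v.\<close>

fun pencil_poly :: "('a::cinner_space \<Rightarrow> 'a) \<Rightarrow> ('a \<Rightarrow> 'a) \<Rightarrow> 'a \<Rightarrow> nat \<Rightarrow> 'a \<Rightarrow> complex poly" where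
  "pencil_poly a b u 0 v = [:cinner u v:]"
| "pencil_poly a b u (Suc n) v = pencil_poly a b u n (a v) + [:0, 1:] * pencil_poly a b u n (b v)"

lemma clinear_op_funpow:
  fixes T :: "'a::cvector \<Rightarrow> 'a"
  shows "clinear_op T \<Longrightarrow> clinear_op (T ^^ n)"
  by (induction n) (auto simp: clinear_op_def)

lemma clinear_op_pencil:
  assumes "clinear_op a" "clinear_op b"
  shows "clinear_op (\<lambda>v. a v + t *\<^sub>C b v)"
  using assms by (auto simp: clinear_op_def scaleC_add_right scaleC_scaleC mult.commute)

lemma poly_pencil_poly:
  assumes "clinear_op a" "clinear_op b"
  shows "poly (pencil_poly a b u n v) t = cinner u (((\<lambda>v. a v + t *\<^sub>C b v) ^^ n) v)"
proof (induction n arbitrary: v)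
  case (Suc n)
  note lin = clinear_op_funpow[OF clinear_op_pencil[OF assms], of n t]
  show ?case
    by (simp add: Suc funpow_Suc_right clinear_opD[OF lin] cinner_add_right cinner_scaleC_right
        del: funpow.simps)
qed simp

text \<open>Turns an operator identity into scalar equations indexed by u and v, the form in which
  elimination applies. The converse direction uses that a vector orthogonal to everything is
  0.\<close>

lemma annihilating_poly_iff_powers_dependent:
  fixes T :: "'a::cinner_space \<Rightarrow> 'a"
  assumes T: "clinear_op T"
  shows "(\<exists>p. p \<noteq> 0 \<and> degree p < n \<and> (\<forall>v. op_poly T p v = 0)) \<longleftrightarrow>
    (\<exists>a. (\<exists>j<n. a j \<noteq> 0) \<and> (\<forall>u v. (\<Sum>j<n. a j * cinner u ((T ^^ j) v)) = 0))"
proof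
  assume "\<exists>p. p \<noteq> 0 \<and> degree p < n \<and> (\<forall>v. op_poly T p v = 0)"
  then obtain p where p: "p \<noteq> 0" "degree p < n" "\<And>v. op_poly T p v = 0" by blast
  have "(\<Sum>j<n. coeff p j * cinner u ((T ^^ j) v)) = cinner u (op_poly T p v)" for u v
  proof -
    have "{..<n} = {..n - 1}" using p(2) by auto
    thus ?thesis using op_poly_eq_sum[OF T, of p "n - 1" v] p(2)
      by (simp add: cinner_sum_right cinner_scaleC_right)
  qed
  thus "\<exists>a. (\<exists>j<n. a j \<noteq> 0) \<and> (\<forall>u v. (\<Sum>j<n. a j * cinner u ((T ^^ j) v)) = 0)"
    using p by (intro exI[of _ "coeff p"] conjI exI[of _ "degree p"]) auto
next
  assume "\<exists>a. (\<exists>j<n. a j \<noteq> 0) \<and> (\<forall>u v. (\<Sum>j<n. a j * cinner u ((T ^^ j) v)) = 0)"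
  then obtain a j0 where a: "\<And>u v. (\<Sum>j<n. a j * cinner u ((T ^^ j) v)) = 0" and j0: "j0 < n" "a j0 \<noteq> 0"
    by blast
  define p where "p = (\<Sum>j<n. monom (a j) j)"
  have "coeff p j0 = (\<Sum>j<n. if j = j0 then a j else 0)"
    unfolding p_def coeff_sum by (intro sum.cong) auto
  hence "coeff p j0 \<noteq> 0" using j0 by simp
  hence "p \<noteq> 0" by auto
  moreover have "degree p < n"
    unfolding p_def using j0 by (intro degree_sum_less) (auto intro: le_less_trans[OF degree_monom_le])
  moreover have "op_poly T p v = 0" for v
  proof -
    have "cinner u (op_poly T p v) = 0" for u
      using a[of u v] by (simp add: p_def op_poly_sum[OF T] op_poly_monom[OF T] cinner_sum_right cinner_scaleC_right)
    thus ?thesis using cinner_self_eq_zero by blast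
  qed
  ultimately show "\<exists>p. p \<noteq> 0 \<and> degree p < n \<and> (\<forall>v. op_poly T p v = 0)" by blast
qed

text \<open>The degrees of annihilating polynomials are bounded on an infinite set of real \<open>t\<close> because
  the reals are uncountable; linear dependence of the powers then persists for all complex \<open>t\<close>.\<close>

lemma algebraic_pencil:
  fixes a b :: "'a::cinner_space \<Rightarrow> 'a"
  assumes a: "clinear_op a" and b: "clinear_op b"
    and alg: "\<And>t. algebraic_op (\<lambda>v. a v + complex_of_real t *\<^sub>C b v)"
  shows "algebraic_op (\<lambda>v. a v + t *\<^sub>C b v)"
proof -
  define h where "h t = (\<lambda>v. a v + t *\<^sub>C b v)" for t
  have h: "clinear_op (h t)" for t
    unfolding h_def by (rule clinear_op_pencil[OF a b])
  define X where "X n = {t. \<exists>p. p \<noteq> 0 \<and> degree p < n \<and> (\<forall>v. op_poly (h (complex_of_real t)) p v = 0)}" for n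
  have "(\<Union>n. X n) = UNIV" using alg unfolding X_def algebraic_op_def h_def by blast
  hence "\<exists>n. infinite (X n)"
    using uncountable_UNIV_real countable_UN[of UNIV X] countable_finite by (metis countableI_type)
  then obtain n where n: "infinite (X n)" by blast
  \<comment> \<open>Columns are indexed by the exponent j, rows by the pairs (u, v).\<close>
  define f where "f j i = pencil_poly a b (fst i) j (snd i)" for j i
  have f: "poly (f j (u, v)) t = cinner u ((h t ^^ j) v)" for j u v t
    by (simp add: f_def poly_pencil_poly[OF a b] h_def)
  have "\<exists>c. (\<exists>j<n. c j \<noteq> 0) \<and> (\<forall>i. (\<Sum>j<n. c j * poly (f j i) t) = 0)"
  proof (rule poly_family_dependent_at)
    show "infinite (complex_of_real ` X n)" using n by (simp add: finite_image_iff inj_on_def)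
    show "\<exists>c. (\<exists>j<n. c j \<noteq> 0) \<and> (\<forall>i. (\<Sum>j<n. c j * poly (f j i) z) = 0)"
      if "z \<in> complex_of_real ` X n" for z
      using that annihilating_poly_iff_powers_dependent[OF h, of n] by (auto simp: X_def f split_paired_all)
  qed
  hence "\<exists>p. p \<noteq> 0 \<and> degree p < n \<and> (\<forall>v. op_poly (h t) p v = 0)"
    unfolding annihilating_poly_iff_powers_dependent[OF h] by (auto simp: f)
  thus ?thesis by (auto simp: algebraic_op_def h_def)
qed

lemma star_subalgebra_algebraic:
  assumes A: "star_subalgebra_BH A" and alg: "\<And>h. h \<in> A \<Longrightarrow> self_adjoint h \<Longrightarrow> algebraic_op h"
    and x: "x \<in> A"
  shows "algebraic_op x"
proof -
  have sub: "subalgebra_BH A" using A by (simp add: star_subalgebra_BH_def)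
  have BH: "A \<subseteq> BH" using sub by (simp add: subalgebra_BH_def)
  have add: "(\<lambda>v. S v + T v) \<in> A" if "S \<in> A" "T \<in> A" for S T
    using sub that by (simp add: subalgebra_BH_def)
  have scale: "(\<lambda>v. c *\<^sub>C S v) \<in> A" if "S \<in> A" for S c
    using sub that by (simp add: subalgebra_BH_def)
  obtain s where s: "s \<in> A" "is_adjoint s x" using A x by (auto simp: star_subalgebra_BH_def)
  have adj: "cinner (x u) v = cinner u (s v)" "cinner (s u) v = cinner u (x v)" for u v
    using s(2) cinner_commute[of "s u" v] cinner_commute[of u "x v"] by (auto simp: is_adjoint_def)
  \<comment> \<open>\<open>a\<close> and \<open>b\<close> are the real and imaginary parts of x; the
    coefficient -i/2 is 1/(2i).\<close>
  define a where "a = (\<lambda>v. (1/2) *\<^sub>C x v + (1/2) *\<^sub>C s v)"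
  define b where "b = (\<lambda>v. (- \<i>/2) *\<^sub>C x v + (\<i>/2) *\<^sub>C s v)"
  have abA: "a \<in> A" "b \<in> A" using add scale x s by (simp_all add: a_def b_def)
  have sa: "self_adjoint a" "self_adjoint b"
    using abA BH unfolding self_adjoint_def
    by (auto simp: a_def b_def adj cinner_add_left cinner_add_right cinner_scaleC_left cinner_scaleC_right)
  have "algebraic_op (\<lambda>v. a v + complex_of_real t *\<^sub>C b v)" for t
    by (intro alg add scale abA self_adjoint_Re_combination sa)
  hence "algebraic_op (\<lambda>v. a v + \<i> *\<^sub>C b v)"
    using algebraic_pencil[OF BH_clinear BH_clinear] abA BH by blast
  moreover have "a v + \<i> *\<^sub>C b v = x v" for v
  proof -
    have "a v + \<i> *\<^sub>C b v = ((1/2) *\<^sub>C x v + (1/2) *\<^sub>C x v) + ((1/2) *\<^sub>C s v + (- (1/2)) *\<^sub>C s v)"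
      by (simp add: a_def b_def scaleC_add_right scaleC_scaleC algebra_simps)
    thus ?thesis by (simp flip: scaleC_add_left) (simp add: scaleC_one)
  qed
  ultimately show ?thesis by simp
qed

section \<open>Finite-dimensional generated subalgebras\<close>

lemma generated_subalgebra_power: "T ^^ Suc k \<in> generated_subalgebra T"
proof -
  have "T ^^ Suc k \<in> B" if "subalgebra_BH B" "T \<in> B" for B
    using that by (induction k) (auto simp: subalgebra_BH_def)
  thus ?thesis by (auto simp: generated_subalgebra_def)
qed

text \<open>The polynomials in T without constant term already form a subalgebra containing T. The
  constant term is excluded since subalgebras need not be unital.\<close>

lemma generated_subalgebra_subset_op_poly:
  assumes T: "T \<in> BH"
  shows "generated_subalgebra T \<subseteq> {op_poly T p | p. coeff p 0 = 0}" (is "_ \<subseteq> ?B")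
proof -
  note lin = BH_clinear[OF T]
  have "subalgebra_BH ?B"
    unfolding subalgebra_BH_def
  proof (intro conjI ballI allI)
    show "?B \<subseteq> BH" using op_poly_BH[OF T] by auto
    show "(\<lambda>v. 0) \<in> ?B" by (auto intro!: exI[of _ 0])
    fix S U c assume "S \<in> ?B" "U \<in> ?B"
    then obtain p q where pq: "S = op_poly T p" "coeff p 0 = 0" "U = op_poly T q" "coeff q 0 = 0" by blast
    have "(\<lambda>v. S v + U v) = op_poly T (p + q)" by (simp add: fun_eq_iff pq op_poly_add[OF lin])
    thus "(\<lambda>v. S v + U v) \<in> ?B" using pq by (auto intro!: exI[of _ "p + q"])
    have "S \<circ> U = op_poly T (p * q)" by (simp add: fun_eq_iff pq op_poly_mult[OF lin])
    thus "S \<circ> U \<in> ?B" using pq by (auto intro!: exI[of _ "p * q"] simp: coeff_mult)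
  next
    fix U c assume "U \<in> ?B"
    then obtain q where q: "U = op_poly T q" "coeff q 0 = 0" by blast
    have "(\<lambda>v. c *\<^sub>C U v) = op_poly T (smult c q)" by (simp add: fun_eq_iff q op_poly_smult[OF lin])
    thus "(\<lambda>v. c *\<^sub>C U v) \<in> ?B" using q by (auto intro!: exI[of _ "smult c q"])
  qed
  moreover have "T = op_poly T [:0, 1:]"
    by (simp add: fun_eq_iff op_poly_pCons[OF lin] clinear_opD[OF lin] scaleC_one)
  hence "T \<in> ?B" by (auto intro!: exI[of _ "[:0, 1:]"])
  ultimately show ?thesis unfolding generated_subalgebra_def by blast
qed

lemma scaleC_sum_left: "(\<Sum>i\<in>I. c i) *\<^sub>C x = (\<Sum>i\<in>I. c i *\<^sub>C (x :: 'a::cvector))"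
  by (induction I rule: infinite_finite_induct) (simp_all add: scaleC_add_left)

text \<open>\<open>op_span\<close> sums over sets of operators, so coefficients of indices with the
  same operator \<open>g i\<close> have to be merged.\<close>

lemma sum_in_op_span:
  assumes "finite I"
  shows "(\<lambda>v. \<Sum>i\<in>I. c i *\<^sub>C g i v) \<in> op_span (g ` I)"
proof -
  define c' where "c' f = (\<Sum>i | i \<in> I \<and> g i = f. c i)" for f
  have "(\<Sum>i\<in>I. c i *\<^sub>C g i v) = (\<Sum>f\<in>g ` I. c' f *\<^sub>C f v)" for v
  proof -
    have "(\<Sum>i\<in>I. c i *\<^sub>C g i v) = (\<Sum>f\<in>g ` I. \<Sum>i | i \<in> I \<and> g i = f. c i *\<^sub>C g i v)"
      by (rule sum.image_gen[OF assms])
    also have "\<dots> = (\<Sum>f\<in>g ` I. c' f *\<^sub>C f v)"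
      unfolding c'_def scaleC_sum_left by (intro sum.cong) auto
    finally show ?thesis .
  qed
  thus ?thesis using assms unfolding op_span_def by blast
qed

lemma algebraic_op_fin_dim:
  assumes T: "T \<in> BH" and alg: "algebraic_op T"
  shows "fin_dim_ops (generated_subalgebra T)"
proof -
  note lin = BH_clinear[OF T]
  obtain p where p: "p \<noteq> 0" "\<And>v. op_poly T p v = 0" using alg by (auto simp: algebraic_op_def)
  \<comment> \<open>Reduction modulo X p instead of p keeps the constant term of the remainder zero,
    so T, ..., T^(degree p) span.\<close>
  define P where "P = [:0, 1:] * p"
  have P: "op_poly T P v = 0" for v
    by (simp add: P_def op_poly_mult[OF lin] p op_poly_pCons[OF lin] clinear_opD[OF lin] del: mult_pCons_left)
  have deg: "degree P = Suc (degree p)" using p(1) by (simp add: P_def)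
  define F where "F = (\<lambda>k. T ^^ k) ` {1..degree p}"
  have "generated_subalgebra T \<subseteq> op_span F"
  proof
    fix S assume "S \<in> generated_subalgebra T"
    then obtain q where q: "S = op_poly T q" "coeff q 0 = 0"
      using generated_subalgebra_subset_op_poly[OF T] by blast
    define r where "r = q mod P"
    have qr: "q = q div P * P + r" by (simp add: r_def)
    have "degree r \<le> degree p"
      using degree_mod_less[of P q] deg by (cases "P = 0") (auto simp: r_def)
    moreover have "coeff r 0 = 0"
      using q(2) arg_cong[OF qr, of "\<lambda>p. coeff p 0"] by (simp add: P_def coeff_mult)
    moreover have "S v = op_poly T r v" for v
      using arg_cong[OF qr, of "\<lambda>p. op_poly T p v"]
      by (simp add: q op_poly_add[OF lin] op_poly_mult[OF lin] P clinear_opD(3)[OF BH_clinear[OF op_poly_BH[OF T]]])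
    moreover have "{..degree p} = insert 0 {1..degree p}" by auto
    ultimately have "S = (\<lambda>v. \<Sum>k\<in>{1..degree p}. coeff r k *\<^sub>C (T ^^ k) v)"
      using op_poly_eq_sum[OF lin, of r "degree p"] by (simp add: fun_eq_iff)
    thus "S \<in> op_span F" unfolding F_def using sum_in_op_span[of "{1..degree p}"] by simp
  qed
  moreover have "F \<subseteq> generated_subalgebra T"
  proof
    fix S assume "S \<in> F"
    then obtain k where "S = T ^^ Suc k" unfolding F_def by (auto simp: Suc_le_eq gr0_conv_Suc)
    thus "S \<in> generated_subalgebra T" using generated_subalgebra_power by blast
  qed
  ultimately show ?thesis unfolding fin_dim_ops_def by (intro exI[of _ F]) (auto simp: F_def)
qed

lemma fin_dim_algebraic_op:
  fixes T :: "'a::cinner_space \<Rightarrow> 'a"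
  assumes T: "T \<in> BH" and fin: "fin_dim_ops (generated_subalgebra T)"
  shows "algebraic_op T"
proof -
  note lin = BH_clinear[OF T]
  interpret vs: vector_space "\<lambda>c (S :: 'a \<Rightarrow> 'a) v. c *\<^sub>C S v"
    by standard (auto simp: fun_eq_iff scaleC_add_right scaleC_add_left scaleC_scaleC scaleC_one)
  have sum_apply: "(\<Sum>i\<in>I. h i) v = (\<Sum>i\<in>I. h i v)" for I :: "('a \<Rightarrow> 'a) set" and h :: "('a \<Rightarrow> 'a) \<Rightarrow> 'a \<Rightarrow> 'a" and v
    by (induction I rule: infinite_finite_induct) simp_all
  obtain F where F: "finite F" "generated_subalgebra T \<subseteq> op_span F"
    using fin by (auto simp: fin_dim_ops_def)
  have "op_span F \<subseteq> vs.span F"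
  proof
    fix S assume "S \<in> op_span F"
    then obtain G c where G: "G \<subseteq> F" "S = (\<lambda>v. \<Sum>f\<in>G. c f *\<^sub>C f v)" by (auto simp: op_span_def)
    have "S = (\<Sum>f\<in>G. (\<lambda>v. c f *\<^sub>C f v))" by (simp add: fun_eq_iff G sum_apply)
    also have "\<dots> \<in> vs.span F"
      using G(1) by (intro vs.span_sum vs.span_scale vs.span_base) auto
    finally show "S \<in> vs.span F" .
  qed
  hence span: "T ^^ Suc k \<in> vs.span F" for k using F(2) generated_subalgebra_power by blast
  \<comment> \<open>The card F + 1 powers with exponents 1, ..., card F + 1 all lie in the span of
    card F operators.\<close>
  define I where "I = {..card F}"
  show ?thesis
  \<comment> \<open>Linear dependence is a property of sets of operators, so coinciding powers are
    treated separately: they give an annihilating difference of two monomials at once.\<close>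
  proof (cases "inj_on (\<lambda>k. T ^^ Suc k) I")
    case True
    let ?S = "(\<lambda>k. T ^^ Suc k) ` I"
    have "card ?S = Suc (card F)" using card_image[OF True] by (simp add: I_def)
    hence "vs.dependent ?S"
      using vs.independent_span_bound[OF F(1), of ?S] span by fastforce
    then obtain u where u: "\<exists>S\<in>?S. u S \<noteq> 0" "(\<Sum>S\<in>?S. (\<lambda>v. u S *\<^sub>C S v)) = 0"
      using vs.dependent_finite[of ?S] by (auto simp: I_def)
    define p where "p = (\<Sum>k\<in>I. monom (u (T ^^ Suc k)) (Suc k))"
    have "op_poly T p v = 0" for v
    proof -
      have "op_poly T p v = (\<Sum>S\<in>?S. u S *\<^sub>C S v)"
        unfolding p_def op_poly_sum[OF lin] op_poly_monom[OF lin] sum.reindex[OF True] by (simp add: o_def)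
      also have "\<dots> = (\<Sum>S\<in>?S. (\<lambda>v. u S *\<^sub>C S v)) v" by (rule sum_apply[symmetric])
      finally show ?thesis using u(2) by simp
    qed
    moreover obtain k where k: "k \<in> I" "u (T ^^ Suc k) \<noteq> 0" using u(1) by blast
    have "coeff p (Suc k) = (\<Sum>j\<in>I. if j = k then u (T ^^ Suc j) else 0)"
      unfolding p_def coeff_sum by (intro sum.cong) auto
    hence "coeff p (Suc k) \<noteq> 0" using k by (simp add: I_def)
    hence "p \<noteq> 0" by auto
    ultimately show ?thesis by (auto simp: algebraic_op_def)
  next
    case False
    then obtain i j where ij: "i \<noteq> j" "T ^^ Suc i = T ^^ Suc j" by (auto simp: inj_on_def)
    let ?p = "monom 1 (Suc i) - monom 1 (Suc j) :: complex poly"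
    have "coeff ?p (Suc i) \<noteq> 0" using ij(1) by simp
    hence "?p \<noteq> 0" by (metis coeff_0)
    moreover have "op_poly T ?p v = 0" for v
      unfolding op_poly_diff[OF lin] op_poly_monom[OF lin] ij(2) by simp
    ultimately show ?thesis unfolding algebraic_op_def by blast
  qed
qed

section \<open>The implications between the six conditions\<close>

theorem theorem2p1:
  fixes A :: "('a::chilbert_space \<Rightarrow> 'a) set"
  assumes "star_subalgebra_BH A"
  shows "((\<forall>x\<in>A. \<exists>y\<in>A. x \<circ> y \<circ> x = x)
            \<longleftrightarrow> (\<forall>x\<in>A. fin_dim_ops (generated_subalgebra x)))
       \<and> ((\<forall>x\<in>A. fin_dim_ops (generated_subalgebra x))
            \<longleftrightarrow> (\<forall>x\<in>A. closed (range x)))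
       \<and> ((\<forall>x\<in>A. closed (range x))
            \<longleftrightarrow> (\<forall>x\<in>A. finite (spectrum_BH x)))
       \<and> ((\<forall>x\<in>A. finite (spectrum_BH x))
            \<longleftrightarrow> (\<forall>x\<in>A. self_adjoint x \<longrightarrow> closed (range x)))
       \<and> ((\<forall>x\<in>A. self_adjoint x \<longrightarrow> closed (range x))
            \<longleftrightarrow> (\<forall>x\<in>A. self_adjoint x \<longrightarrow> finite (spectrum_BH x)))"
proof -
  have sub: "subalgebra_BH A" using assms by (simp add: star_subalgebra_BH_def)
  hence BH: "x \<in> BH" if "x \<in> A" for x using that by (auto simp: subalgebra_BH_def)
  \<comment> \<open>\<open>S\<close> yields both regularity and finite-dimensionality. Regularity
    gives closed ranges, in particular for self-adjoint elements, hence finite spectra of these,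
    which returns to \<open>S\<close>. Finite-dimensionality gives finite spectra of all elements
    and joins the same path.\<close>
  define S where "S \<longleftrightarrow> (\<forall>h\<in>A. self_adjoint h \<longrightarrow> algebraic_op h)"
  have S1: "\<forall>x\<in>A. \<exists>y\<in>A. x \<circ> y \<circ> x = x" if S
    using algebraic_imp_regular[OF assms] that by (auto simp: S_def)
  have S2: "\<forall>x\<in>A. fin_dim_ops (generated_subalgebra x)" if S
    using star_subalgebra_algebraic[OF assms] algebraic_op_fin_dim BH that by (auto simp: S_def)
  have 13: "\<forall>x\<in>A. closed (range x)" if "\<forall>x\<in>A. \<exists>y\<in>A. x \<circ> y \<circ> x = x"
    using that quasi_inverse_closed_range BH by blast
  have 24: "\<forall>x\<in>A. finite (spectrum_BH x)" if "\<forall>x\<in>A. fin_dim_ops (generated_subalgebra x)"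
    using that fin_dim_algebraic_op algebraic_op_finite_spectrum BH unfolding algebraic_op_def by metis
  have 56: "\<forall>x\<in>A. self_adjoint x \<longrightarrow> finite (spectrum_BH x)"
    if closed: "\<forall>x\<in>A. self_adjoint x \<longrightarrow> closed (range x)"
  proof (intro ballI impI, rule ccontr)
    fix T assume T: "T \<in> A" "self_adjoint T" "infinite (spectrum_BH T)"
    obtain a where a: "self_adjoint (op_poly T [:0, - complex_of_real a, 1:])"
      "\<not> closed (range (op_poly T [:0, - complex_of_real a, 1:]))"
      using infinite_spectrum_not_closed_range[OF T(2,3)] by blast
    note lin = BH_clinear[OF BH[OF T(1)]]
    \<comment> \<open>T - a may lie outside \<open>A\<close>; the factor T on the right puts the
      product into \<open>A\<close>.\<close>
    have "op_poly T [:0, - complex_of_real a, 1:] = op_poly T [:- complex_of_real a, 1:] \<circ> T"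
      unfolding fun_eq_iff comp_def op_poly_commute[OF lin] op_poly_pCons[OF lin, of 0] by simp
    hence "op_poly T [:0, - complex_of_real a, 1:] \<in> A"
      using op_poly_comp_in_subalgebra[OF sub T(1) T(1)] by simp
    with closed a show False by blast
  qed
  have 6: S if "\<forall>x\<in>A. self_adjoint x \<longrightarrow> finite (spectrum_BH x)"
    using that self_adjoint_finite_spectrum_algebraic by (auto simp: S_def)
  show ?thesis using S1 S2 13 24 56 6 by blast
qed

end
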